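(* Let $1\le k<n\le m_L\le J$ with $J\neq m_L$, and consider the $(J\times n,q^{Jk},d)$ circular-shift-based MRD codes $\mathcal{C}_1$ and $\mathcal{C}_2$ with exponents $l_0,\dots,l_{n-1}$. Suppose $l_j=c'j+c \bmod L$ for all $0\le j\le n-1$, where $0\le c\le L-1$ and $1\le c'\le L-1$ are fixed constants such that $\sum_{j=0}^{k-1}c'q^{j}$ is coprime to $L$. Then both $\mathcal{C}_1$ and $\mathcal{C}_2$ are different (as sets of matrices) from every $(J\times n,q^{Jk},d)$ twisted Gabidulin MRD code $\mathcal{M}_{\mathcal{B}}(\mathcal{S})$ with $h=0$, regardless of the choice of the basis $\mathcal{B}$ of $\mathbb{F}_{q^J}$ over $\mathbb{F}_q$ and of the twisted Gabidulin (linear) code $\mathcal{S}$ over $\mathbb{F}_{q^J}$.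
   Context: Setting. $q$ is a prime, $L$ is a positive integer with $\gcd(q,L)=1$, $m_L$ is the multiplicative order of $q$ modulo $L$, $\mathcal{J}=\{j:1\le j\le L-1,\ \gcd(j,L)=1\}$, $J=|\mathcal{J}|$, and $m_L\le J$ (automatic for $L\ge 2$). $L_{\mathbb{F}_q}=L \bmod q$ is regarded as a nonzero element of $\mathbb{F}_q$. $\beta\in\mathbb{F}_{q^{m_L}}$ is a primitive $L$-th root of unity. $\mathbf{C}_L=\begin{bmatrix}\mathbf{0}&\mathbf{I}_{L-1}\\1&\mathbf{0}\end{bmatrix}$ is the $L\times L$ cyclic permutation matrix over $\mathbb{F}_q$. $\mathbf{V}_L=[\beta^{ij}]_{0\le i,j\le L-1}$ and $\widetilde{\mathbf{V}}_L=[\beta^{-ij}]_{0\le i,j\le L-1}$. $[\mathbf{x}_j]_{j\in\mathcal{J}}$ denotes juxtaposition of columns in increasing order of $j$; $j\notin\mathcal J$ means $0\le j\le L-1$, $j\notin\mathcal{J}$. $\tau(x)=\prod_{0\le j\le L-1,\,j\notin\mathcal{J}}(x-\beta^j)\in\mathbb{F}_q[x]$. $\mathbf{U}=[\mathbf{u}_j]_{0\le j\le L-1}$ and $\mathbf{U}'=[\mathbf{u}'_j]_{0\le j\le L-1}$ are matrices in $\mathbb{F}_{q^{m_L}}^{J\times L}$ (columns indexed from $0$) satisfying: $\mathrm{rank}([\mathbf{u}_j]_{j\in\mathcal{J}})=J$; $[\mathbf{u}'_j]_{j\in\mathcal{J}}^{\mathrm T}=L_{\mathbb{F}_q}^{-1}[\mathbf{u}_j]_{j\in\mathcal{J}}^{-1}$;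 and $[\mathbf{u}_j]_{j\notin\mathcal{J}}=\mathbf{0}$ or $[\mathbf{u}'_j]_{j\notin\mathcal{J}}=\mathbf{0}$. Put $\mathbf{G}_L=\mathbf{U}\widetilde{\mathbf{V}}_L$ and $\mathbf{H}_L=\mathbf{V}_L\mathbf{U}'^{\mathrm T}$; it is assumed that both have all entries in $\mathbb{F}_q$. Codes. For $\mathbf{P}\in\mathbb{F}_q^{J\times L}$, $\mathbf{Q}\in\mathbb{F}_q^{L\times J}$ and distinct exponents $0\le l_0,\dots,l_{n-1}\le L-1$, the circular-shift-based rank-metric code is the set of all matrices $[\mathbf{c}_0^{\mathrm T}\ \cdots\ \mathbf{c}_{n-1}^{\mathrm T}]\in\mathbb{F}_q^{J\times n}$ with $\mathbf{c}_i=\sum_{s=0}^{k-1}\mathbf{m}_s\mathbf{P}\mathbf{C}_L^{q^sl_i}\mathbf{Q}$, where $(\mathbf{m}_0,\dots,\mathbf{m}_{k-1})$ ranges over $k$-tuples of row vectors in $\mathbb{F}_q^J$. $\mathcal{C}_1$ is this code for $\mathbf{P}=\mathbf{G}_L,\mathbf{Q}=\mathbf{H}_L$, and $\mathcal{C}_2$ is this code for $\mathbf{P}=\mathbf{G}_L,\mathbf{Q}=\tau(\mathbf{C}_L)\mathbf{G}_L^{\mathrm T}$ (same exponents). They are called circular-shift-based MRD codes when the exponents satisfy $\mathrm{rank}(\sum_{i=0}^{n-1}a_i\mathbf{P}\mathbf{C}_L^{l_i}\mathbf{Q})=J$ for all nonzero $[a_0,\dots,a_{n-1}]\in\mathbb{F}_q^n$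 (the condition is the same for both choices of $\mathbf{Q}$); they then have $q^{Jk}$ elements and minimum rank distance $d=n-k+1$. A code in $\mathbb{F}_q^{N\times n}$ ($n\le N$) with minimum rank distance $d$ is MRD if it has $q^{N(n-d+1)}$ elements. Twisted Gabidulin codes. Let $\beta_0,\dots,\beta_{n-1}\in\mathbb{F}_{q^N}$ be $\mathbb{F}_q$-linearly independent, $h\ge 0$ an integer, and $\eta\in\mathbb{F}_{q^N}$ with $\eta^{(q^N-1)/(q-1)}\neq(-1)^{nk}$. Let $\mathcal{H}=\{u_0x+u_1x^q+\cdots+u_{k-1}x^{q^{k-1}}+\eta u_0^{q^h}x^{q^k}:u_0,\dots,u_{k-1}\in\mathbb{F}_{q^N}\}$. The twisted Gabidulin code over $\mathbb{F}_{q^N}$ is $\mathcal{S}=\{[f(\beta_0)\ \cdots\ f(\beta_{n-1})]:f\in\mathcal{H}\}$. For a basis $\mathcal{B}$ of $\mathbb{F}_{q^N}$ over $\mathbb{F}_q$, written as a row vector in $\mathbb{F}_{q^N}^N$, $\mathcal{M}_{\mathcal{B}}(\mathcal{S})$ is the set of the matrices $\mathbf{M}\in\mathbb{F}_q^{N\times n}$ with $\mathcal{B}\mathbf{M}\in\mathcal{S}$. Here $N=J$. *)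

theory Defs
  imports
    "HOL-Library.Cardinality"
    "HOL-Number_Theory.Number_Theory"
    "Jordan_Normal_Form.DL_Submatrix"
    "Jordan_Normal_Form.DL_Rank"
    "Jordan_Normal_Form.Gauss_Jordan_Elimination"
begin

text \<open>
  Three fields occur: the prime field (type \<open>'a\<close>), the extension containing the \<open>L\<close>-th roots of
  unity (type \<open>'b\<close>) and the extension over which the twisted Gabidulin codes are linear
  (type \<open>'c\<close>). The prime field is embedded in the other two by field homomorphisms
  \<open>\<phi>\<close> and \<open>\<psi>\<close>. Row vectors are one-row matrices; all indices start at 0.
\<close>

definition coprime_idx :: "nat \<Rightarrow> nat set" where
  "coprime_idx L = {j. 1 \<le> j \<and> j \<le> L - 1 \<and> coprime j L}"

definition primitive_root_of_unity :: "nat \<Rightarrow> 'b::field \<Rightarrow> bool" where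
  "primitive_root_of_unity L \<beta> \<longleftrightarrow> \<beta> ^ L = 1 \<and> (\<forall>i. 0 < i \<and> i < L \<longrightarrow> \<beta> ^ i \<noteq> 1)"

definition cyclic_mat :: "nat \<Rightarrow> 'a::field mat" where
  "cyclic_mat L = four_block_mat (0\<^sub>m (L - 1) 1) (1\<^sub>m (L - 1)) (1\<^sub>m 1) (0\<^sub>m 1 (L - 1))"

definition vandermonde_mat :: "nat \<Rightarrow> 'b::field \<Rightarrow> 'b mat" where
  "vandermonde_mat L \<beta> = mat L L (\<lambda>(i, j). \<beta> ^ (i * j))"

definition vandermonde_inv_mat :: "nat \<Rightarrow> 'b::field \<Rightarrow> 'b mat" where
  "vandermonde_inv_mat L \<beta> = mat L L (\<lambda>(i, j). inverse (\<beta> ^ (i * j)))"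

text \<open>Juxtaposition, in increasing order, of the columns of \<open>A\<close> with index in \<open>I\<close>.\<close>

definition select_cols :: "'b mat \<Rightarrow> nat set \<Rightarrow> 'b mat" where
  "select_cols A I = submatrix A UNIV I"

text \<open>
  The product over \<open>j \<notin> \<J>\<close> of \<open>x - \<beta>^j\<close>, read as a polynomial over the prime field. The
  description is unique because \<open>\<phi>\<close> is injective; a polynomial satisfying it exists because the
  root set is stable under the Frobenius map.
\<close>

definition tau_poly :: "('a::field \<Rightarrow> 'b::field) \<Rightarrow> nat \<Rightarrow> 'b \<Rightarrow> 'a poly" where
  "tau_poly \<phi> L \<beta> =
    (THE p. map_poly \<phi> p = (\<Prod>j\<in>{0..<L} - coprime_idx L. [:- (\<beta> ^ j), 1:]))"

definition poly_at_mat :: "'a::field poly \<Rightarrow> 'a mat \<Rightarrow> 'a mat" where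
  "poly_at_mat p A = mat (dim_row A) (dim_row A)
     (\<lambda>(i, j). \<Sum>s\<le>degree p. coeff p s * (A ^\<^sub>m s) $$ (i, j))"

text \<open>
  In the code with matrices \<open>P\<close>, \<open>Q\<close> and exponents \<open>l\<close>, column \<open>i\<close> of a codeword is the
  transpose of the row vector that is the sum over \<open>s < k\<close> of \<open>m s * P * C^(q^s * l i) * Q\<close>.
\<close>

definition cs_code ::
  "nat \<Rightarrow> nat \<Rightarrow> nat \<Rightarrow> nat \<Rightarrow> nat \<Rightarrow> (nat \<Rightarrow> nat) \<Rightarrow> 'a::field mat \<Rightarrow> 'a mat \<Rightarrow> 'a mat set" where
  "cs_code q L J k n l P Q =
    {mat J n (\<lambda>(r, i). \<Sum>s<k. (m s * P * cyclic_mat L ^\<^sub>m (q ^ s * l i) * Q) $$ (0, r)) | m.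
      \<forall>s<k. m s \<in> carrier_mat 1 J}"

definition cs_mrd_exponents ::
  "nat \<Rightarrow> nat \<Rightarrow> nat \<Rightarrow> (nat \<Rightarrow> nat) \<Rightarrow> 'a::field mat \<Rightarrow> 'a mat \<Rightarrow> bool" where
  "cs_mrd_exponents L J n l P Q \<longleftrightarrow>
    inj_on l {..<n} \<and> (\<forall>i<n. l i < L) \<and>
    (\<forall>a :: nat \<Rightarrow> 'a. (\<exists>i<n. a i \<noteq> 0) \<longrightarrow>
      vec_space.rank J
        (mat J J (\<lambda>(r, t). \<Sum>i<n. a i * (P * cyclic_mat L ^\<^sub>m l i * Q) $$ (r, t))) = J)"

text \<open>Families indexed by \<open>{..<n}\<close> in an extension field, seen as a vector space through \<open>\<psi>\<close>.\<close>

definition lin_indep_family :: "('a::field \<Rightarrow> 'c::field) \<Rightarrow> nat \<Rightarrow> (nat \<Rightarrow> 'c) \<Rightarrow> bool" where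
  "lin_indep_family \<psi> n b \<longleftrightarrow>
    inj_on b {..<n} \<and> \<not> Modules.module.dependent (\<lambda>a x. \<psi> a * x) (b ` {..<n})"

definition basis_family :: "('a::field \<Rightarrow> 'c::field) \<Rightarrow> nat \<Rightarrow> (nat \<Rightarrow> 'c) \<Rightarrow> bool" where
  "basis_family \<psi> N B \<longleftrightarrow>
    lin_indep_family \<psi> N B \<and> Modules.module.span (\<lambda>a x. \<psi> a * x) (B ` {..<N}) = UNIV"

definition row_mat :: "nat \<Rightarrow> (nat \<Rightarrow> 'c) \<Rightarrow> 'c mat" where
  "row_mat n v = mat 1 n (\<lambda>(_, i). v i)"

definition twisted_polys :: "nat \<Rightarrow> nat \<Rightarrow> nat \<Rightarrow> 'c::field \<Rightarrow> 'c poly set" where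
  "twisted_polys q k h \<eta> =
    {(\<Sum>i<k. monom (u i) (q ^ i)) + monom (\<eta> * u 0 ^ (q ^ h)) (q ^ k) | u :: nat \<Rightarrow> 'c. True}"

definition twisted_gabidulin ::
  "nat \<Rightarrow> nat \<Rightarrow> nat \<Rightarrow> nat \<Rightarrow> 'c::field \<Rightarrow> (nat \<Rightarrow> 'c) \<Rightarrow> 'c mat set" where
  "twisted_gabidulin q n k h \<eta> b = {row_mat n (\<lambda>i. poly f (b i)) | f. f \<in> twisted_polys q k h \<eta>}"

text \<open>The exponent of \<open>\<eta>\<close> is the norm exponent; the division by \<open>q - 1\<close> is exact.\<close>

definition twisted_gabidulin_params ::
  "('a::field \<Rightarrow> 'c::field) \<Rightarrow> nat \<Rightarrow> nat \<Rightarrow> nat \<Rightarrow> nat \<Rightarrow> 'c \<Rightarrow> (nat \<Rightarrow> 'c) \<Rightarrow> bool" where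
  "twisted_gabidulin_params \<psi> q N n k \<eta> b \<longleftrightarrow>
    lin_indep_family \<psi> n b \<and> \<eta> ^ ((q ^ N - 1) div (q - 1)) \<noteq> (- 1) ^ (n * k)"

definition matrix_code ::
  "('a::field \<Rightarrow> 'c::field) \<Rightarrow> nat \<Rightarrow> nat \<Rightarrow> (nat \<Rightarrow> 'c) \<Rightarrow> 'c mat set \<Rightarrow> 'a mat set" where
  "matrix_code \<psi> N n B S = {M \<in> carrier_mat N n. row_mat N B * map_mat \<psi> M \<in> S}"

end

theory Submission
  imports Defs "Jordan_Normal_Form.Char_Poly"
begin

text \<open>
  Over the extension containing \<open>\<beta>\<close>, the matrices \<open>G * C^l * Q\<close> are simultaneously diagonalised: up to
  fixed invertible factors they become \<open>diag(\<beta>^(j * l))\<close> with \<open>j\<close> coprime to \<open>L\<close>. Since the exponents form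
  an arithmetic progression, the columns of a codeword are, in the \<open>j\<close>-th eigencoordinate \<open>\<chi> j\<close>, power
  sums in \<open>\<beta>^(j * c' * q^s)\<close>, \<open>s < k\<close>, and so satisfy a linear recurrence of order \<open>k\<close>. If the columns
  \<open>1, ..., k - 1\<close> of a codeword vanish, column \<open>k\<close> is therefore column \<open>0\<close> with its \<open>j\<close>-th coordinate
  multiplied by \<open>\<zeta> j = \<plusminus> \<beta>^(j * (\<Sum>s<k. c' * q^s))\<close>; these factors are pairwise distinct.

  A twisted Gabidulin code with \<open>h = 0\<close> is closed under scalars of the field of order \<open>q^J\<close>. If it were
  the same code, scaling one nonzero word of this shape would show that the map from column \<open>0\<close> to column
  \<open>k\<close> is multiplication by some \<open>\<delta>\<close> in that field. For a polynomial \<open>p\<close> over the prime field,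
  \<open>p \<delta> \<noteq> 0\<close> is invertible, so \<open>p (\<zeta> j) = 0\<close> for a single \<open>j\<close> forces \<open>p \<delta> = 0\<close> and then
  \<open>p (\<zeta> j) = 0\<close> for all \<open>J\<close> indices. Hence the \<open>q^J\<close> polynomials of degree below \<open>J\<close> take distinct values
  at one \<open>\<zeta> j\<close>, which is impossible in a field with \<open>q^m < q^J\<close> elements.
\<close>

subsection \<open>Eigenfunctionals of a multiplication map\<close>

text \<open>By Horner's scheme, an eigenfunctional of multiplication by \<open>\<delta>\<close> is
  also one of multiplication by every polynomial in \<open>\<delta>\<close> with coefficients from
  \<open>'a\<close>.\<close>

lemma hom_eval_semilinear:
  fixes \<phi> :: "'a::field \<Rightarrow> 'b::field" and \<psi> :: "'a \<Rightarrow> 'c::field" and f :: "'c \<Rightarrow> 'b"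
  assumes "field_hom \<phi>" and "field_hom \<psi>"
    and add: "\<And>x y. f (x + y) = f x + f y"
    and scale: "\<And>a x. f (\<psi> a * x) = \<phi> a * f x"
    and eig: "\<And>x. f (x * \<delta>) = z * f x"
  shows "f (x * poly (map_poly \<psi> p) \<delta>) = poly (map_poly \<phi> p) z * f x"
proof -
  interpret \<phi>: field_hom \<phi> by fact
  interpret \<psi>: field_hom \<psi> by fact
  have f0: "f 0 = 0"
    using scale[of 0 0] by simp
  show ?thesis
  proof (induction p arbitrary: x)
    case 0
    then show ?case by (simp add: f0)
  next
    case (pCons a p)
    have "f (x * poly (map_poly \<psi> (pCons a p)) \<delta>)
        = f (\<psi> a * x + (x * \<delta>) * poly (map_poly \<psi> p) \<delta>)"
      by (simp add: Polynomial.map_poly_pCons algebra_simps)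
    also have "\<dots> = \<phi> a * f x + poly (map_poly \<phi> p) z * (z * f x)"
      by (simp only: add scale pCons.IH eig)
    finally show ?case
      by (simp add: Polynomial.map_poly_pCons algebra_simps)
  qed
qed

text \<open>Multiplication by the value of \<open>p\<close> at \<open>\<delta>\<close> is zero or
  invertible, so a root of \<open>p\<close> at one eigenvalue forces roots at all of them. Hence
  evaluation at a single \<open>z j0\<close> is injective on the polynomials over \<open>'a\<close>
  of degree below \<open>card I\<close>.\<close>

lemma card_power_le_of_eigenfunctionals:
  fixes \<phi> :: "'a::{field,finite} \<Rightarrow> 'b::{field,finite}" and \<psi> :: "'a \<Rightarrow> 'c::field"
    and f :: "'i \<Rightarrow> 'c \<Rightarrow> 'b"
  assumes hom: "field_hom \<phi>" "field_hom \<psi>" and fin: "finite I"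
    and add: "\<And>j x y. j \<in> I \<Longrightarrow> f j (x + y) = f j x + f j y"
    and scale: "\<And>j a x. j \<in> I \<Longrightarrow> f j (\<psi> a * x) = \<phi> a * f j x"
    and nz: "\<And>j. j \<in> I \<Longrightarrow> \<exists>x. f j x \<noteq> 0"
    and inj: "inj_on z I"
    and eig: "\<And>j x. j \<in> I \<Longrightarrow> f j (x * \<delta>) = z j * f j x"
  shows "CARD('a) ^ card I \<le> CARD('b)"
proof (cases "I = {}")
  case True
  then show ?thesis by (simp add: Suc_leI)
next
  case False
  then obtain j0 where j0: "j0 \<in> I" by auto
  interpret \<phi>: field_hom \<phi> by fact
  interpret \<psi>: field_hom \<psi> by fact
  let ?n = "card I"
  let ?F = "{..<?n} \<rightarrow>\<^sub>E (UNIV :: 'a set)"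
  have "?n > 0" using fin False by auto
  have "inj_on (\<lambda>h. \<Sum>i<?n. \<phi> (h i) * z j0 ^ i) ?F"
  proof (rule inj_onI)
    fix g h assume g: "g \<in> ?F" and h: "h \<in> ?F"
      and eq: "(\<Sum>i<?n. \<phi> (g i) * z j0 ^ i) = (\<Sum>i<?n. \<phi> (h i) * z j0 ^ i)"
    \<comment> \<open>The difference of the two polynomials; \<open>z j0\<close> is one of its
      roots.\<close>
    define p where "p = (\<Sum>i<?n. monom (g i - h i) i)"
    have coeff_p: "coeff p i = (if i < ?n then g i - h i else 0)" for i
      by (simp add: p_def coeff_sum)
    have deg: "degree p < ?n"
      using \<open>?n > 0\<close> by (intro degree_lessI) (auto simp: coeff_p)
    have eval: "poly (map_poly \<phi> p) x = (\<Sum>i<?n. \<phi> (g i - h i) * x ^ i)" for x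
    proof -
      have "map_poly \<phi> p = (\<Sum>i<?n. monom (\<phi> (g i - h i)) i)"
        by (intro poly_eqI) (simp add: coeff_map_poly coeff_p coeff_sum)
      then show ?thesis by (simp add: poly_sum poly_monom)
    qed
    have root0: "poly (map_poly \<phi> p) (z j0) = 0"
      using eq by (simp add: eval \<phi>.hom_minus algebra_simps sum_subtractf)
    have ev: "f j (x * poly (map_poly \<psi> p) \<delta>) = poly (map_poly \<phi> p) (z j) * f j x"
      if "j \<in> I" for j x
      using hom_eval_semilinear[OF hom add scale eig] that by blast
    \<comment> \<open>Otherwise every \<open>x\<close> is a multiple of this value, and
      \<open>f j0\<close> would vanish identically.\<close>
    have d0: "poly (map_poly \<psi> p) \<delta> = 0"
    proof (rule ccontr)
      assume d: "poly (map_poly \<psi> p) \<delta> \<noteq> 0"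
      obtain x where "f j0 x \<noteq> 0" using nz j0 by blast
      with d ev[OF j0, of "x / poly (map_poly \<psi> p) \<delta>"] root0 show False by simp
    qed
    have "poly (map_poly \<phi> p) (z j) = 0" if j: "j \<in> I" for j
    proof -
      obtain x where "f j x \<noteq> 0" using nz j by blast
      moreover have "f j 0 = 0" using scale[OF j, of 0 0] by (simp add: \<psi>.hom_zero)
      ultimately show ?thesis using ev[OF j, of x] d0 by simp
    qed
    then have roots: "z ` I \<subseteq> {x. poly (map_poly \<phi> p) x = 0}" by auto
    have "map_poly \<phi> p = 0"
    proof (rule ccontr)
      assume nz: "map_poly \<phi> p \<noteq> 0"
      have "?n = card (z ` I)" using inj by (simp add: card_image)
      also have "\<dots> \<le> card {x. poly (map_poly \<phi> p) x = 0}"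
        using roots by (intro card_mono) auto
      also have "\<dots> \<le> degree (map_poly \<phi> p)"
        using nz by (rule card_poly_roots_bound)
      also have "\<dots> \<le> degree p"
        by (intro degree_le) (auto simp: coeff_map_poly coeff_eq_0)
      finally show False using deg by simp
    qed
    then have "p = 0" by simp
    then have "g i = h i" if "i < ?n" for i
      using coeff_p[of i] that by simp
    then show "g = h"
      using g h by (intro PiE_ext) auto
  qed
  then have "card ?F \<le> CARD('b)"
    by (intro card_inj_on_le[of _ _ UNIV]) auto
  then show ?thesis by (simp add: card_PiE)
qed

subsection \<open>Power sums\<close>

text \<open>Weighting the power sums by the coefficients of \<open>P\<close> produces values of
  \<open>P\<close> at the nodes, so the roots of \<open>P\<close> decide which nodes
  survive.\<close>

lemma sum_coeff_power_sums:
  fixes g y :: "nat \<Rightarrow> 'b::comm_ring_1"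
  shows "(\<Sum>i\<le>degree P. coeff P i * (\<Sum>s<k. g s ^ i * y s)) = (\<Sum>s<k. poly P (g s) * y s)"
proof -
  have "(\<Sum>i\<le>degree P. coeff P i * (\<Sum>s<k. g s ^ i * y s))
      = (\<Sum>s<k. \<Sum>i\<le>degree P. coeff P i * g s ^ i * y s)"
    by (subst sum.swap) (simp add: sum_distrib_left mult.assoc)
  then show ?thesis
    by (simp add: poly_altdef sum_distrib_right)
qed

text \<open>Lagrange's argument in place of a determinant: the equations are combined by a
  polynomial that vanishes at every node except \<open>g s\<close>, which isolates
  \<open>y s\<close>.\<close>

lemma vandermonde_kernel_trivial:
  fixes g y :: "nat \<Rightarrow> 'b::field"
  assumes inj: "inj_on g {..<k}" and zero: "\<And>i. i < k \<Longrightarrow> (\<Sum>s<k. g s ^ i * y s) = 0"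
    and s: "s < k"
  shows "y s = 0"
proof -
  define P where "P = (\<Prod>t\<in>{..<k} - {s}. [:- g t, 1:])"
  have "degree P \<le> (\<Sum>t\<in>{..<k} - {s}. degree [:- g t, 1:])"
    unfolding P_def using degree_prod_sum_le[of "{..<k} - {s}" "\<lambda>t. [:- g t, 1:]"] by (simp add: o_def)
  also have "\<dots> = k - 1" using s by simp
  finally have deg: "degree P < k" using s by simp
  have "0 = (\<Sum>t<k. poly P (g t) * y t)"
    using deg zero by (subst sum_coeff_power_sums[symmetric]) (auto intro!: sum.neutral)
  also have "\<dots> = (\<Sum>t\<in>{s}. poly P (g t) * y t)"
    using s by (intro sum.mono_neutral_right)
      (auto simp: P_def poly_prod intro!: prod_zero)
  finally have "poly P (g s) = 0 \<or> y s = 0" by simp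
  moreover have "poly P (g s) \<noteq> 0"
    using inj s by (auto simp: P_def poly_prod inj_on_def)
  ultimately show ?thesis by simp
qed

text \<open>
  The power sums satisfy the linear recurrence whose characteristic polynomial is the product of the
  \<open>x - g s\<close>; only its extreme coefficients survive here.
\<close>

lemma power_sum_recurrence:
  fixes g y :: "nat \<Rightarrow> 'b::field"
  assumes k: "0 < k" and zero: "\<And>i. 1 \<le> i \<Longrightarrow> i < k \<Longrightarrow> (\<Sum>s<k. g s ^ i * y s) = 0"
  shows "(\<Sum>s<k. g s ^ k * y s) = - (\<Prod>s<k. - g s) * (\<Sum>s<k. y s)"
proof -
  define P where "P = (\<Prod>t<k. [:- g t, 1:])"
  define W where "W i = (\<Sum>s<k. g s ^ i * y s)" for i
  have deg: "degree P = k"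
    unfolding P_def by (subst degree_prod_eq_sum_degree) auto
  have "lead_coeff P = 1"
    by (simp add: P_def lead_coeff_prod)
  then have ck: "coeff P k = 1" using deg by simp
  have c0: "coeff P 0 = (\<Prod>s<k. - g s)"
    by (simp add: P_def poly_0_coeff_0[symmetric] poly_prod)
  have "0 = (\<Sum>t<k. poly P (g t) * y t)"
    by (subst sum.neutral) (auto simp: P_def poly_prod intro!: prod_zero)
  also have "\<dots> = (\<Sum>i\<le>k. coeff P i * W i)"
    unfolding W_def by (subst sum_coeff_power_sums[symmetric]) (simp add: deg)
  also have "\<dots> = (\<Sum>i\<in>{0,k}. coeff P i * W i)"
    using zero by (intro sum.mono_neutral_right) (auto simp: W_def)
  also have "\<dots> = coeff P 0 * W 0 + W k"
    using k ck by simp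
  finally show ?thesis
    by (simp add: c0 W_def eq_neg_iff_add_eq_0 add.commute)
qed

subsection \<open>Diagonalisation of the cyclic shift\<close>

lemma cyclic_mat_carrier: "L > 0 \<Longrightarrow> cyclic_mat L \<in> carrier_mat L L"
  by (intro carrier_matI) (simp_all add: cyclic_mat_def)

lemma cyclic_mat_index:
  assumes "i < L" "j < L"
  shows "cyclic_mat L $$ (i, j) = (if j = Suc i mod L then 1 else 0)"
  using assms unfolding cyclic_mat_def
  by (cases "Suc i = L") (auto simp: index_mat_four_block one_mat_def)

lemma cyclic_mat_pow_index:
  assumes "i < L" "j < L"
  shows "(cyclic_mat L ^\<^sub>m l :: 'a::field mat) $$ (i, j) = (if j = (i + l) mod L then 1 else 0)"
  using assms
proof (induction l arbitrary: j)
  case 0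
  then show ?case
    using carrier_matD(1)[OF cyclic_mat_carrier[of L, where 'a = 'a]] by auto
next
  case (Suc l)
  have C: "(cyclic_mat L :: 'a mat) \<in> carrier_mat L L"
    using Suc.prems by (intro cyclic_mat_carrier) simp
  then have Cl: "(cyclic_mat L ^\<^sub>m l :: 'a mat) \<in> carrier_mat L L" by simp
  have "(cyclic_mat L ^\<^sub>m Suc l :: 'a mat) $$ (i, j)
      = (\<Sum>t<L. (cyclic_mat L ^\<^sub>m l) $$ (i, t) * cyclic_mat L $$ (t, j))"
    using Suc.prems C Cl by (simp add: scalar_prod_def atLeast0LessThan)
  also have "\<dots> = (\<Sum>t<L. if t = (i + l) mod L then cyclic_mat L $$ (t, j) else 0)"
    using Suc by (intro sum.cong) auto
  also have "\<dots> = cyclic_mat L $$ ((i + l) mod L, j)"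
    using Suc.prems by simp
  also have "\<dots> = (if j = (i + Suc l) mod L then 1 else 0)"
    using Suc.prems by (simp add: cyclic_mat_index mod_Suc_eq)
  finally show ?case .
qed

section \<open>Powers of a primitive root of unity\<close>

lemma primitive_root_power_mod:
  assumes "primitive_root_of_unity L \<beta>"
  shows "\<beta> ^ (a mod L) = \<beta> ^ a"
proof -
  have "\<beta> ^ a = \<beta> ^ (L * (a div L) + a mod L)" by simp
  also have "\<dots> = \<beta> ^ (a mod L)"
    using assms unfolding power_add power_mult by (simp add: primitive_root_of_unity_def)
  finally show ?thesis ..
qed

lemma primitive_root_nonzero:
  "L > 0 \<Longrightarrow> primitive_root_of_unity L \<beta> \<Longrightarrow> \<beta> \<noteq> 0"
  by (auto simp: primitive_root_of_unity_def power_0_left)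

lemma primitive_root_power_eq_iff:
  assumes L: "L > 0" and prim: "primitive_root_of_unity L \<beta>"
  shows "\<beta> ^ a = \<beta> ^ b \<longleftrightarrow> [a = b] (mod L)"
proof
  have *: "x = y" if "\<beta> ^ x = \<beta> ^ y" "x \<le> y" "y < L" for x y
  proof (rule ccontr)
    assume "x \<noteq> y"
    have "\<beta> ^ y = \<beta> ^ x * \<beta> ^ (y - x)"
      using that by (metis le_add_diff_inverse power_add)
    then have "\<beta> ^ (y - x) = 1"
      using that primitive_root_nonzero[OF L prim] by simp
    then show False
      using prim that \<open>x \<noteq> y\<close> by (auto simp: primitive_root_of_unity_def)
  qed
  assume "\<beta> ^ a = \<beta> ^ b"
  then have "\<beta> ^ (a mod L) = \<beta> ^ (b mod L)"
    by (simp add: primitive_root_power_mod[OF prim])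
  then have "a mod L = b mod L"
    using *[of "a mod L" "b mod L"] *[of "b mod L" "a mod L"] L
    by (metis mod_less_divisor nle_le)
  then show "[a = b] (mod L)" by (simp add: cong_def)
next
  assume "[a = b] (mod L)"
  then show "\<beta> ^ a = \<beta> ^ b"
    by (metis cong_def prim primitive_root_power_mod)
qed

text \<open>For distinct \<open>a\<close> and \<open>b\<close> the sum is geometric, with ratio an
  \<open>L\<close>-th root of unity other than 1. The two Vandermonde matrices are thus inverse only
  up to the factor \<open>of_nat L\<close>, which reappears below.\<close>

lemma root_of_unity_orthogonality:
  assumes L: "L > 0" and prim: "primitive_root_of_unity L \<beta>" and ab: "a < L" "b < L"
  shows "(\<Sum>i<L. inverse (\<beta> ^ (i * a)) * \<beta> ^ (i * b)) = (if a = b then of_nat L else 0)"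
proof (cases "a = b")
  case True
  then show ?thesis
    using primitive_root_nonzero[OF L prim] by simp
next
  case False
  note nz = primitive_root_nonzero[OF L prim]
  define r where "r = \<beta> ^ b / \<beta> ^ a"
  have "r \<noteq> 1"
    using False ab nz primitive_root_power_eq_iff[OF L prim, of b a]
    by (auto simp: r_def cong_def)
  have "r ^ L = (\<beta> ^ L) ^ b / (\<beta> ^ L) ^ a"
    by (simp add: r_def power_divide mult.commute flip: power_mult)
  then have "r ^ L = 1"
    using prim by (simp add: primitive_root_of_unity_def)
  have "inverse (\<beta> ^ (i * a)) * \<beta> ^ (i * b) = r ^ i" for i
    by (simp add: r_def divide_inverse power_mult_distrib power_inverse mult.commute[of i] power_mult)
  then have "(\<Sum>i<L. inverse (\<beta> ^ (i * a)) * \<beta> ^ (i * b)) = (\<Sum>i<L. r ^ i)"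
    by simp
  also have "\<dots> = 0"
    using \<open>r \<noteq> 1\<close> \<open>r ^ L = 1\<close> by (simp add: geometric_sum)
  finally show ?thesis using False by simp
qed

section \<open>Entries of shifted products, and codewords in eigencoordinates\<close>

lemma mult_mat_index:
  assumes "A \<in> carrier_mat n l" "B \<in> carrier_mat l p" "i < n" "j < p"
  shows "(A * B) $$ (i, j) = (\<Sum>t<l. A $$ (i, t) * B $$ (t, j))"
  using assms by (simp add: scalar_prod_def atLeast0LessThan)

lemma mult_vandermonde_inv_index:
  assumes "U \<in> carrier_mat J L" "r < J" "i < L"
  shows "(U * vandermonde_inv_mat L \<beta>) $$ (r, i) = (\<Sum>j<L. U $$ (r, j) * inverse (\<beta> ^ (i * j)))"
  using assms by (simp add: vandermonde_inv_mat_def scalar_prod_def atLeast0LessThan mult.commute)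

lemma vandermonde_mult_transpose_index:
  assumes "V \<in> carrier_mat J L" "t < J" "i < L"
  shows "(vandermonde_mat L \<beta> * transpose_mat V) $$ (i, t) = (\<Sum>j<L. \<beta> ^ (i * j) * V $$ (t, j))"
  using assms by (simp add: vandermonde_mat_def scalar_prod_def atLeast0LessThan)

lemma cyclic_mat_pow_sandwich:
  fixes G Q :: "'a::field mat"
  assumes L: "L > 0" and G: "G \<in> carrier_mat J L" and Q: "Q \<in> carrier_mat L J'" and rt: "r < J" "t < J'"
  shows "(G * cyclic_mat L ^\<^sub>m l * Q) $$ (r, t) = (\<Sum>i<L. G $$ (r, i) * Q $$ ((i + l) mod L, t))"
proof -
  let ?C = "cyclic_mat L ^\<^sub>m l :: 'a mat"
  have C: "?C \<in> carrier_mat L L"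
    using cyclic_mat_carrier[OF L] by (rule pow_carrier_mat)
  then have CQ: "?C * Q \<in> carrier_mat L J'" using Q by simp
  have "(?C * Q) $$ (i, t) = Q $$ ((i + l) mod L, t)" if i: "i < L" for i
  proof -
    have "(?C * Q) $$ (i, t) = (\<Sum>j<L. ?C $$ (i, j) * Q $$ (j, t))"
      using C Q i rt(2) by (rule mult_mat_index)
    also have "\<dots> = (\<Sum>j<L. if j = (i + l) mod L then Q $$ (j, t) else 0)"
      using i by (intro sum.cong) (auto simp: cyclic_mat_pow_index)
    also have "\<dots> = Q $$ ((i + l) mod L, t)" using L by simp
    finally show ?thesis .
  qed
  then have "(G * (?C * Q)) $$ (r, t) = (\<Sum>i<L. G $$ (r, i) * Q $$ ((i + l) mod L, t))"
    using rt by (simp add: mult_mat_index[OF G CQ])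
  then show ?thesis
    using assoc_mult_mat[OF G C Q] by simp
qed

text \<open>Shifting the rows of \<open>vandermonde_mat\<close> cyclically by \<open>l\<close>
  multiplies column \<open>j\<close> by \<open>\<beta> ^ (j * l)\<close>. Orthogonality then leaves
  only the terms pairing column \<open>j\<close> of \<open>U\<close> with column \<open>j\<close> of
  \<open>V\<close>.\<close>

lemma cyclic_mat_pow_diagonalised:
  fixes G Q :: "'a::field mat" and U V :: "'b::field mat"
  assumes L: "L > 0" and hom: "field_hom \<phi>" and prim: "primitive_root_of_unity L \<beta>"
    and U: "U \<in> carrier_mat J L" and V: "V \<in> carrier_mat J L"
    and G: "G \<in> carrier_mat J L" "map_mat \<phi> G = U * vandermonde_inv_mat L \<beta>"
    and Q: "Q \<in> carrier_mat L J" "map_mat \<phi> Q = vandermonde_mat L \<beta> * transpose_mat V"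
    and rt: "r < J" "t < J"
  shows "\<phi> ((G * cyclic_mat L ^\<^sub>m l * Q) $$ (r, t))
    = of_nat L * (\<Sum>j<L. U $$ (r, j) * \<beta> ^ (j * l) * V $$ (t, j))"
proof -
  interpret \<phi>: field_hom \<phi> by fact
  have Gi: "\<phi> (G $$ (r, i)) = (\<Sum>j<L. U $$ (r, j) * inverse (\<beta> ^ (i * j)))" if "i < L" for i
    using mult_vandermonde_inv_index[OF U rt(1) that, of \<beta>] G rt that
    by (metis carrier_matD index_map_mat(1))
  have Qi: "\<phi> (Q $$ ((i + l) mod L, t)) = (\<Sum>j<L. \<beta> ^ (i * j) * \<beta> ^ (j * l) * V $$ (t, j))" for i
  proof -
    have "(i + l) mod L < L" using L by simp
    then have "\<phi> (Q $$ ((i + l) mod L, t)) = (\<Sum>j<L. \<beta> ^ ((i + l) mod L * j) * V $$ (t, j))"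
      using vandermonde_mult_transpose_index[OF V rt(2), of "(i + l) mod L" \<beta>] Q rt
      by (metis carrier_matD index_map_mat(1))
    moreover have "\<beta> ^ ((i + l) mod L * j) = \<beta> ^ (i * j) * \<beta> ^ (j * l)" for j
      by (simp add: power_mult primitive_root_power_mod[OF prim])
        (simp add: power_add power_mult_distrib mult.commute flip: power_mult)
    ultimately show ?thesis by simp
  qed
  have "\<phi> ((G * cyclic_mat L ^\<^sub>m l * Q) $$ (r, t))
      = (\<Sum>i<L. \<phi> (G $$ (r, i)) * \<phi> (Q $$ ((i + l) mod L, t)))"
    using cyclic_mat_pow_sandwich[OF L G(1) Q(1) rt, of l] by (simp add: \<phi>.hom_sum \<phi>.hom_mult)
  also have "\<dots> = (\<Sum>i<L. \<Sum>j<L. \<Sum>j'<L. (U $$ (r, j) * inverse (\<beta> ^ (i * j)))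
      * (\<beta> ^ (i * j') * \<beta> ^ (j' * l) * V $$ (t, j')))"
    by (intro sum.cong refl) (simp add: Gi Qi sum_product)
  \<comment> \<open>The sum over \<open>i\<close> moves innermost, where orthogonality
    applies.\<close>
  also have "\<dots> = (\<Sum>j<L. \<Sum>j'<L. \<Sum>i<L. (U $$ (r, j) * inverse (\<beta> ^ (i * j)))
      * (\<beta> ^ (i * j') * \<beta> ^ (j' * l) * V $$ (t, j')))"
    by (subst sum.swap, rule sum.cong[OF refl], rule sum.swap)
  also have "\<dots> = (\<Sum>j<L. \<Sum>j'<L. U $$ (r, j) * \<beta> ^ (j' * l) * V $$ (t, j')
      * (\<Sum>i<L. inverse (\<beta> ^ (i * j)) * \<beta> ^ (i * j')))"
    by (simp add: sum_distrib_left mult_ac)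
  also have "\<dots> = (\<Sum>j<L. \<Sum>j'<L. if j = j' then U $$ (r, j) * \<beta> ^ (j' * l) * V $$ (t, j') * of_nat L else 0)"
    by (intro sum.cong refl) (simp add: root_of_unity_orthogonality[OF L prim])
  also have "\<dots> = of_nat L * (\<Sum>j<L. U $$ (r, j) * \<beta> ^ (j * l) * V $$ (t, j))"
    by (simp add: sum_distrib_left mult_ac)
  finally show ?thesis .
qed

lemma row_mult_sandwich_index:
  fixes G Q :: "'a::field mat"
  assumes L: "L > 0" and G: "G \<in> carrier_mat J L" and Q: "Q \<in> carrier_mat L J"
    and m: "m \<in> carrier_mat 1 J" and t: "t < J"
  shows "(m * G * cyclic_mat L ^\<^sub>m l * Q) $$ (0, t)
    = (\<Sum>r<J. m $$ (0, r) * (G * cyclic_mat L ^\<^sub>m l * Q) $$ (r, t))"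
proof -
  let ?C = "cyclic_mat L ^\<^sub>m l :: 'a mat"
  have C: "?C \<in> carrier_mat L L"
    using cyclic_mat_carrier[OF L] by (rule pow_carrier_mat)
  have "m * G * ?C * Q = m * (G * ?C * Q)"
    using assoc_mult_mat[OF m G C] assoc_mult_mat[OF m mult_carrier_mat[OF G C] Q] by simp
  moreover have "(m * (G * ?C * Q)) $$ (0, t) = (\<Sum>r<J. m $$ (0, r) * (G * ?C * Q) $$ (r, t))"
    using m mult_carrier_mat[OF mult_carrier_mat[OF G C] Q] _ t by (rule mult_mat_index) simp
  ultimately show ?thesis by simp
qed

text \<open>\<open>Z\<close> is dual to the columns of \<open>V\<close> with index in
  \<open>I\<close>, so pairing a codeword column with \<open>Z\<close> extracts its
  \<open>j\<close>-th eigencoordinate, in which each shift acts by a single power of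
  \<open>\<beta>\<close>. The condition \<open>supp\<close> removes the indices outside
  \<open>I\<close>.\<close>

lemma codeword_functional:
  fixes G Q :: "'a::field mat" and U V :: "'b::field mat" and Z :: "nat \<Rightarrow> nat \<Rightarrow> 'b"
  assumes L: "L > 0" and hom: "field_hom \<phi>" and prim: "primitive_root_of_unity L \<beta>"
    and U: "U \<in> carrier_mat J L" and V: "V \<in> carrier_mat J L"
    and G: "G \<in> carrier_mat J L" "map_mat \<phi> G = U * vandermonde_inv_mat L \<beta>"
    and Q: "Q \<in> carrier_mat L J" "map_mat \<phi> Q = vandermonde_mat L \<beta> * transpose_mat V"
    and I: "I \<subseteq> {..<L}"
    and supp: "\<And>j r t. j < L \<Longrightarrow> j \<notin> I \<Longrightarrow> r < J \<Longrightarrow> t < J \<Longrightarrow> U $$ (r, j) * V $$ (t, j) = 0"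
    and Z: "\<And>i j. i \<in> I \<Longrightarrow> j \<in> I \<Longrightarrow>
        of_nat L * (\<Sum>t<J. V $$ (t, i) * Z t j) = (if i = j then 1 else 0)"
    and m: "\<And>s. s < k \<Longrightarrow> m s \<in> carrier_mat 1 J" and j: "j \<in> I"
  shows "(\<Sum>t<J. \<phi> (\<Sum>s<k. (m s * G * cyclic_mat L ^\<^sub>m e s * Q) $$ (0, t)) * Z t j)
    = (\<Sum>s<k. \<beta> ^ (j * e s) * (\<Sum>r<J. \<phi> (m s $$ (0, r)) * U $$ (r, j)))"
proof -
  interpret \<phi>: field_hom \<phi> by fact
  have X: "(\<Sum>t<J. \<phi> ((G * cyclic_mat L ^\<^sub>m l * Q) $$ (r, t)) * Z t j) = U $$ (r, j) * \<beta> ^ (j * l)"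
    if r: "r < J" for r l
  proof -
    have "\<phi> ((G * cyclic_mat L ^\<^sub>m l * Q) $$ (r, t))
        = of_nat L * (\<Sum>i\<in>I. U $$ (r, i) * \<beta> ^ (i * l) * V $$ (t, i))" if "t < J" for t
    proof -
      have "(\<Sum>i<L. U $$ (r, i) * \<beta> ^ (i * l) * V $$ (t, i))
          = (\<Sum>i\<in>I. U $$ (r, i) * \<beta> ^ (i * l) * V $$ (t, i))"
        using I supp r that by (intro sum.mono_neutral_right) fastforce+
      then show ?thesis
        using cyclic_mat_pow_diagonalised[OF L hom prim U V G Q r that, of l] by simp
    qed
    then have "(\<Sum>t<J. \<phi> ((G * cyclic_mat L ^\<^sub>m l * Q) $$ (r, t)) * Z t j)
        = (\<Sum>t<J. \<Sum>i\<in>I. of_nat L * (U $$ (r, i) * \<beta> ^ (i * l) * V $$ (t, i)) * Z t j)"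
      by (simp add: sum_distrib_left sum_distrib_right)
    also have "\<dots> = (\<Sum>i\<in>I. \<Sum>t<J. of_nat L * (U $$ (r, i) * \<beta> ^ (i * l) * V $$ (t, i)) * Z t j)"
      by (rule sum.swap)
    also have "\<dots> = (\<Sum>i\<in>I. U $$ (r, i) * \<beta> ^ (i * l) * (of_nat L * (\<Sum>t<J. V $$ (t, i) * Z t j)))"
      by (simp add: sum_distrib_left mult_ac)
    also have "\<dots> = (\<Sum>i\<in>I. if i = j then U $$ (r, i) * \<beta> ^ (i * l) else 0)"
      using j by (intro sum.cong refl) (simp add: Z)
    also have "\<dots> = U $$ (r, j) * \<beta> ^ (j * l)"
      using j finite_subset[OF I] by simp
    finally show ?thesis .
  qed
  have "(\<Sum>t<J. \<phi> (\<Sum>s<k. (m s * G * cyclic_mat L ^\<^sub>m e s * Q) $$ (0, t)) * Z t j)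
      = (\<Sum>t<J. \<Sum>s<k. \<Sum>r<J. \<phi> (m s $$ (0, r))
          * (\<phi> ((G * cyclic_mat L ^\<^sub>m e s * Q) $$ (r, t)) * Z t j))"
  proof (rule sum.cong[OF refl])
    fix t assume "t \<in> {..<J}"
    then have "\<phi> ((m s * G * cyclic_mat L ^\<^sub>m e s * Q) $$ (0, t)) * Z t j
        = (\<Sum>r<J. \<phi> (m s $$ (0, r)) * (\<phi> ((G * cyclic_mat L ^\<^sub>m e s * Q) $$ (r, t)) * Z t j))"
      if "s < k" for s
      using row_mult_sandwich_index[OF L G(1) Q(1) m[OF that], of t "e s"]
      by (simp add: \<phi>.hom_sum \<phi>.hom_mult sum_distrib_right mult.assoc)
    then show "\<phi> (\<Sum>s<k. (m s * G * cyclic_mat L ^\<^sub>m e s * Q) $$ (0, t)) * Z t j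
        = (\<Sum>s<k. \<Sum>r<J. \<phi> (m s $$ (0, r))
            * (\<phi> ((G * cyclic_mat L ^\<^sub>m e s * Q) $$ (r, t)) * Z t j))"
      by (simp add: \<phi>.hom_sum sum_distrib_right)
  qed
  also have "\<dots> = (\<Sum>s<k. \<Sum>r<J. \<Sum>t<J. \<phi> (m s $$ (0, r))
          * (\<phi> ((G * cyclic_mat L ^\<^sub>m e s * Q) $$ (r, t)) * Z t j))"
    by (subst sum.swap, rule sum.cong[OF refl], rule sum.swap)
  also have "\<dots> = (\<Sum>s<k. \<Sum>r<J. \<phi> (m s $$ (0, r)) * (U $$ (r, j) * \<beta> ^ (j * e s)))"
    by (intro sum.cong refl) (simp add: X flip: sum_distrib_left)
  also have "\<dots> = (\<Sum>s<k. \<beta> ^ (j * e s) * (\<Sum>r<J. \<phi> (m s $$ (0, r)) * U $$ (r, j)))"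
    by (simp add: sum_distrib_left mult_ac)
  finally show ?thesis .
qed

subsection \<open>Codes closed under scalars\<close>

text \<open>Pigeonhole: over a finite field there are more assignments than value vectors, so two
  assignments collide, and their difference solves the homogeneous system.\<close>

lemma nontrivial_solution_of_linear_system:
  fixes A :: "'t \<Rightarrow> 's \<Rightarrow> 'a::{field,finite}"
  assumes fin: "finite S" "finite T" and card: "card T < card S"
  shows "\<exists>x. (\<exists>s\<in>S. x s \<noteq> 0) \<and> (\<forall>t\<in>T. (\<Sum>s\<in>S. A t s * x s) = 0)"
proof -
  let ?X = "S \<rightarrow>\<^sub>E (UNIV :: 'a set)" and ?Y = "T \<rightarrow>\<^sub>E (UNIV :: 'a set)"
  define F where "F x = (\<lambda>t\<in>T. \<Sum>s\<in>S. A t s * x s)" for x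
  have "card (UNIV :: 'a set) > 1"
    using card_mono[of UNIV "{0, 1 :: 'a}"] by simp
  then have "card ?Y < card ?X"
    using fin card by (simp add: card_PiE)
  moreover have "F ` ?X \<subseteq> ?Y" by (auto simp: F_def)
  moreover have "finite ?Y" using fin by (intro finite_PiE) auto
  ultimately have "\<not> inj_on F ?X"
    by (meson card_inj_on_le leD)
  then obtain f g where f: "f \<in> ?X" and g: "g \<in> ?X" and neq: "f \<noteq> g" and eq: "F f = F g"
    by (auto simp: inj_on_def)
  have "\<exists>s\<in>S. f s - g s \<noteq> 0"
  proof (rule ccontr)
    assume "\<not> ?thesis"
    then have "f = g" using f g by (intro PiE_ext) auto
    with neq show False ..
  qed
  moreover have "(\<Sum>s\<in>S. A t s * (f s - g s)) = 0" if "t \<in> T" for t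
    using fun_cong[OF eq, of t] that by (simp add: F_def algebra_simps sum_subtractf)
  ultimately show ?thesis
    by (intro exI[of _ "\<lambda>s. f s - g s"]) auto
qed

text \<open>Spanning gives the existence of coordinates and independence their uniqueness. Both
  notions concern the set of basis vectors; injectivity of \<open>B\<close> passes from vectors to
  indices.\<close>

lemma basis_family_coordinates:
  fixes \<psi> :: "'a::field \<Rightarrow> 'c::field"
  assumes "field_hom \<psi>" and "basis_family \<psi> N B"
  obtains \<kappa> where "\<And>x. (\<Sum>t<N. B t * \<psi> (\<kappa> x t)) = x"
    and "\<And>v t. t < N \<Longrightarrow> \<kappa> (\<Sum>t<N. B t * \<psi> (v t)) t = v t"
proof -
  interpret \<psi>: field_hom \<psi> by fact
  interpret M: Modules.module "\<lambda>a x. \<psi> a * x"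
    by unfold_locales (simp_all add: algebra_simps \<psi>.hom_add \<psi>.hom_mult)
  have inj: "inj_on B {..<N}" and ind: "\<not> M.dependent (B ` {..<N})"
    and span: "M.span (B ` {..<N}) = UNIV"
    using assms(2) by (auto simp: basis_family_def lin_indep_family_def)
  have "\<exists>v. (\<Sum>t<N. B t * \<psi> (v t)) = x" for x
  proof -
    have "x \<in> range (\<lambda>u. \<Sum>v\<in>B ` {..<N}. \<psi> (u v) * v)"
      using span M.span_finite[of "B ` {..<N}"] by simp
    then obtain u where "x = (\<Sum>v\<in>B ` {..<N}. \<psi> (u v) * v)" by auto
    then have "(\<Sum>t<N. B t * \<psi> (u (B t))) = x"
      using inj by (simp add: sum.reindex mult.commute)
    then show ?thesis by (rule exI[of _ "\<lambda>t. u (B t)"])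
  qed
  then obtain \<kappa> where \<kappa>: "\<And>x. (\<Sum>t<N. B t * \<psi> (\<kappa> x t)) = x" by metis
  have unique: "v t = w t" if eq: "(\<Sum>t<N. B t * \<psi> (v t)) = (\<Sum>t<N. B t * \<psi> (w t))" and t: "t < N"
    for v w t
  proof -
    \<comment> \<open>The difference of the coordinates as a function on vectors:
      \<open>the_inv_into\<close> recovers the index of a basis vector.\<close>
    define u where "u b = v (the_inv_into {..<N} B b) - w (the_inv_into {..<N} B b)" for b
    have u: "u (B t) = v t - w t" if "t < N" for t
      using that inj by (simp add: u_def the_inv_into_f_f)
    have "(\<Sum>b\<in>B ` {..<N}. \<psi> (u b) * b) = (\<Sum>t<N. \<psi> (v t - w t) * B t)"
      using inj by (simp add: sum.reindex u)
    also have "\<dots> = 0"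
      using eq by (simp add: \<psi>.hom_minus algebra_simps sum_subtractf)
    finally have "u (B t) = 0"
      using M.independentD[OF ind, of "B ` {..<N}" u "B t"] t by auto
    then show ?thesis using u t by simp
  qed
  show thesis
    using that[of \<kappa>] \<kappa> unique by blast
qed

text \<open>For \<open>h = 0\<close> the top coefficient is \<open>\<eta> * u 0\<close>, so scaling
  a word by \<open>a\<close> amounts to scaling every \<open>u i\<close> by \<open>a\<close>. In
  general that coefficient would scale by \<open>a ^ (q ^ h)\<close> instead.\<close>

lemma twisted_gabidulin_smult_closed:
  assumes "w \<in> twisted_gabidulin q n k 0 \<eta> b"
  shows "a \<cdot>\<^sub>m w \<in> twisted_gabidulin q n k 0 \<eta> b"
proof -
  obtain u where w: "w = row_mat n (\<lambda>i. poly ((\<Sum>i<k. monom (u i) (q ^ i)) + monom (\<eta> * u 0 ^ (q ^ 0)) (q ^ k)) (b i))"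
    using assms by (auto simp: twisted_gabidulin_def twisted_polys_def)
  let ?f = "(\<Sum>i<k. monom (a * u i) (q ^ i)) + monom (\<eta> * (a * u 0) ^ (q ^ 0)) (q ^ k)"
  have "a \<cdot>\<^sub>m w = row_mat n (\<lambda>i. poly ?f (b i))"
    by (auto simp: w row_mat_def poly_sum poly_monom sum_distrib_left algebra_simps)
  moreover have "?f \<in> twisted_polys q k 0 \<eta>"
    unfolding twisted_polys_def by (intro CollectI exI[of _ "\<lambda>i. a * u i"]) simp
  ultimately show ?thesis
    unfolding twisted_gabidulin_def by blast
qed

text \<open>Both codes of the theorem are instances of this comparison with a set \<open>S\<close>
  of rows closed under scalars. \<open>Z\<close> inverts \<open>V\<close> on \<open>I\<close> and
  defines the eigencoordinates; \<open>W\<close> inverts \<open>U\<close> on \<open>I\<close> and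
  recovers a message from its transform.\<close>

lemma cs_code_neq_matrix_code:
  fixes \<phi> :: "'a::{field,finite} \<Rightarrow> 'b::{field,finite}" and \<psi> :: "'a \<Rightarrow> 'c::field"
    and G Q :: "'a mat" and U V :: "'b mat" and W Z :: "nat \<Rightarrow> nat \<Rightarrow> 'b"
  assumes L: "L > 0" and hom: "field_hom \<phi>" "field_hom \<psi>" and prim: "primitive_root_of_unity L \<beta>"
    and U: "U \<in> carrier_mat J L" and V: "V \<in> carrier_mat J L"
    and G: "G \<in> carrier_mat J L" "map_mat \<phi> G = U * vandermonde_inv_mat L \<beta>"
    and Q: "Q \<in> carrier_mat L J" "map_mat \<phi> Q = vandermonde_mat L \<beta> * transpose_mat V"
    and I: "I \<subseteq> {..<L}" "card I = J" and J: "J > 0"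
    and supp: "\<And>j r t. j < L \<Longrightarrow> j \<notin> I \<Longrightarrow> r < J \<Longrightarrow> t < J \<Longrightarrow> U $$ (r, j) * V $$ (t, j) = 0"
    and Z: "\<And>i j. i \<in> I \<Longrightarrow> j \<in> I \<Longrightarrow>
        of_nat L * (\<Sum>t<J. V $$ (t, i) * Z t j) = (if i = j then 1 else 0)"
    and W: "\<And>r t. r < J \<Longrightarrow> t < J \<Longrightarrow> (\<Sum>j\<in>I. U $$ (r, j) * W t j) = (if r = t then 1 else 0)"
    and k: "1 \<le> k" "k < n" and l: "\<And>i. i < n \<Longrightarrow> l i = (c' * i + c) mod L"
    and inj_s: "\<And>j. j \<in> I \<Longrightarrow> inj_on (\<lambda>s. \<beta> ^ (j * c' * q ^ s)) {..<k}"
    and inj_j: "inj_on (\<lambda>j. \<beta> ^ (j * (\<Sum>s<k. c' * q ^ s))) I"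
    and card: "CARD('b) < CARD('a) ^ J"
    and B: "basis_family \<psi> J B"
    and S: "\<And>a w. w \<in> S \<Longrightarrow> a \<cdot>\<^sub>m w \<in> S"
  shows "cs_code q L J k n l G Q \<noteq> matrix_code \<psi> J n B S"
proof
  assume eq: "cs_code q L J k n l G Q = matrix_code \<psi> J n B S"
  interpret \<phi>: field_hom \<phi> by fact
  interpret \<psi>: field_hom \<psi> by fact
  obtain \<kappa> where \<kappa>: "\<And>x. (\<Sum>t<J. B t * \<psi> (\<kappa> x t)) = x"
    and \<kappa>_eq: "\<And>v t. t < J \<Longrightarrow> \<kappa> (\<Sum>t<J. B t * \<psi> (v t)) t = v t"
    using basis_family_coordinates[OF hom(2) B] by blast
  \<comment> \<open>Taking coordinates in the basis \<open>B\<close> and embedding them by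
    \<open>\<phi>\<close> gives functionals from one extension field to the other.\<close>
  define \<chi> where "\<chi> j x = (\<Sum>t<J. \<phi> (\<kappa> x t) * Z t j)" for j x
  have \<chi>_eq: "\<chi> j (\<Sum>t<J. B t * \<psi> (v t)) = (\<Sum>t<J. \<phi> (v t) * Z t j)" for j v
    by (simp add: \<chi>_def \<kappa>_eq)
  have \<chi>_add: "\<chi> j (x + y) = \<chi> j x + \<chi> j y" for j x y
  proof -
    have "x + y = (\<Sum>t<J. B t * \<psi> (\<kappa> x t)) + (\<Sum>t<J. B t * \<psi> (\<kappa> y t))"
      by (simp add: \<kappa>)
    then have "x + y = (\<Sum>t<J. B t * \<psi> (\<kappa> x t + \<kappa> y t))"
      by (simp add: \<psi>.hom_add distrib_left sum.distrib)
    then show ?thesis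
      by (simp add: \<chi>_eq) (simp add: \<chi>_def \<phi>.hom_add distrib_right sum.distrib)
  qed
  have \<chi>_scale: "\<chi> j (\<psi> a * x) = \<phi> a * \<chi> j x" for j a x
  proof -
    have "\<psi> a * x = \<psi> a * (\<Sum>t<J. B t * \<psi> (\<kappa> x t))"
      by (simp add: \<kappa>)
    then have "\<psi> a * x = (\<Sum>t<J. B t * \<psi> (a * \<kappa> x t))"
      by (simp add: \<psi>.hom_mult sum_distrib_left mult_ac)
    then show ?thesis
      by (simp add: \<chi>_eq) (simp add: \<chi>_def \<phi>.hom_mult sum_distrib_left mult.assoc)
  qed
  have \<chi>_0: "\<chi> j 0 = 0" for j
    using \<chi>_scale[of j 0 0] by simp
  have \<chi>_nz: "\<exists>x. \<chi> j x \<noteq> 0" if j: "j \<in> I" for j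
  proof -
    have "(\<Sum>t<J. V $$ (t, j) * Z t j) \<noteq> 0" using Z[OF j j] by auto
    then obtain t where t: "t < J" "Z t j \<noteq> 0"
      by (metis (no_types, lifting) lessThan_iff mult_zero_right sum.neutral)
    have "\<chi> j (\<Sum>t'<J. B t' * \<psi> (if t' = t then 1 else 0)) = (\<Sum>t'<J. if t' = t then Z t' j else 0)"
      unfolding \<chi>_eq by (intro sum.cong) auto
    then have "\<chi> j (\<Sum>t'<J. B t' * \<psi> (if t' = t then 1 else 0)) \<noteq> 0"
      using t by simp
    then show ?thesis by blast
  qed

  \<comment> \<open>The nodes of the power sums. Column \<open>i\<close> carries the exponents
    \<open>q ^ s * (c' * i + c)\<close>, so it depends on \<open>i\<close> only through
    \<open>g j s ^ i\<close>; the offset \<open>c\<close> goes into the weight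
    \<open>y\<close>.\<close>
  define g where "g j s = \<beta> ^ (j * c' * q ^ s)" for j s
  define message where "message m \<longleftrightarrow> (\<forall>s<k. m s \<in> carrier_mat 1 J)" for m :: "nat \<Rightarrow> 'a mat"
  define M where "M m = mat J n (\<lambda>(r, i).
      \<Sum>s<k. (m s * G * cyclic_mat L ^\<^sub>m (q ^ s * l i) * Q) $$ (0, r))" for m :: "nat \<Rightarrow> 'a mat"
  define y where "y m j s = \<beta> ^ (j * (q ^ s * c)) * (\<Sum>r<J. \<phi> (m s $$ (0, r)) * U $$ (r, j))"
    for m :: "nat \<Rightarrow> 'a mat" and j s
  define w where "w m i = (\<Sum>t<J. B t * \<psi> (M m $$ (t, i)))" for m i
  have w_row: "row_mat J B * map_mat \<psi> (M m) = row_mat n (w m)" for m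
    by (rule eq_matI) (simp_all add: row_mat_def M_def w_def scalar_prod_def atLeast0LessThan)
  have code: "M m \<in> cs_code q L J k n l G Q" if "message m" for m
    using that unfolding cs_code_def M_def message_def by blast
  have \<chi>_w: "\<chi> j (w m i) = (\<Sum>s<k. g j s ^ i * y m j s)"
    if m: "message m" and j: "j \<in> I" and i: "i < n" for m j i
  proof -
    have "\<beta> ^ (j * (q ^ s * l i)) = g j s ^ i * \<beta> ^ (j * (q ^ s * c))" for s
    proof -
      have "\<beta> ^ (j * (q ^ s * l i)) = (\<beta> ^ l i) ^ (j * q ^ s)"
        by (simp add: mult_ac flip: power_mult)
      also have "\<dots> = (\<beta> ^ (c' * i + c)) ^ (j * q ^ s)"
        using l[OF i] by (simp add: primitive_root_power_mod[OF prim])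
      also have "\<dots> = g j s ^ i * \<beta> ^ (j * (q ^ s * c))"
        by (simp add: g_def algebra_simps flip: power_mult power_add)
      finally show ?thesis .
    qed
    moreover have "\<chi> j (w m i)
        = (\<Sum>t<J. \<phi> (\<Sum>s<k. (m s * G * cyclic_mat L ^\<^sub>m (q ^ s * l i) * Q) $$ (0, t)) * Z t j)"
      using i by (simp add: w_def \<chi>_eq M_def)
    moreover have "\<dots> = (\<Sum>s<k. \<beta> ^ (j * (q ^ s * l i)) * (\<Sum>r<J. \<phi> (m s $$ (0, r)) * U $$ (r, j)))"
      by (rule codeword_functional[OF L hom(1) prim U V G Q I(1)])
        (use supp Z m j in \<open>auto simp: message_def\<close>)
    ultimately show ?thesis
      by (simp add: y_def mult.assoc)
  qed
  have g_inj: "inj_on (g j) {..<k}" if "j \<in> I" for j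
    using inj_s[OF that] by (simp add: g_def[abs_def])
  define \<zeta> where "\<zeta> j = - (\<Prod>s<k. - g j s)" for j
  have last: "\<chi> j (w m k) = \<zeta> j * \<chi> j (w m 0)"
    if m: "message m" and j: "j \<in> I"
      and zero: "\<And>i. 1 \<le> i \<Longrightarrow> i < k \<Longrightarrow> w m i = 0" for m j
  proof -
    have "(\<Sum>s<k. g j s ^ i * y m j s) = 0" if i: "1 \<le> i" "i < k" for i
      using \<chi>_w[OF m j, of i] i k \<chi>_0 zero[OF i] by simp
    then show ?thesis
      using power_sum_recurrence[of k "g j" "y m j"] k \<chi>_w[OF m j, of k] \<chi>_w[OF m j, of 0]
      by (simp add: \<zeta>_def)
  qed
  \<comment> \<open>The first \<open>k\<close> columns determine the message: the Vandermonde system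
    kills the weights \<open>y\<close>, and \<open>W\<close> undoes the transform by
    \<open>U\<close>.\<close>
  have message_0: "m s $$ (0, r) = 0"
    if m: "message m" and zero: "\<And>i. i < k \<Longrightarrow> w m i = 0"
      and s: "s < k" and r: "r < J" for m s r
  proof -
    have "y m j s = 0" if j: "j \<in> I" for j
    proof (rule vandermonde_kernel_trivial[OF g_inj[OF j] _ s])
      fix i assume i: "i < k"
      then show "(\<Sum>s<k. g j s ^ i * y m j s) = 0"
        using \<chi>_w[OF m j, of i] k zero[OF i] by (simp add: \<chi>_0)
    qed
    then have 0: "(\<Sum>r'<J. \<phi> (m s $$ (0, r')) * U $$ (r', j)) = 0" if "j \<in> I" for j
      using that primitive_root_nonzero[OF L prim] by (simp add: y_def)
    have "\<phi> (m s $$ (0, r)) = (\<Sum>r'<J. if r' = r then \<phi> (m s $$ (0, r')) else 0)"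
      using r by simp
    also have "\<dots> = (\<Sum>r'<J. \<phi> (m s $$ (0, r')) * (\<Sum>j\<in>I. U $$ (r', j) * W r j))"
      using W r by (intro sum.cong) auto
    also have "\<dots> = (\<Sum>j\<in>I. (\<Sum>r'<J. \<phi> (m s $$ (0, r')) * U $$ (r', j)) * W r j)"
      by (simp add: sum_distrib_left sum_distrib_right mult.assoc) (rule sum.swap)
    also have "\<dots> = 0" by (simp add: 0)
    finally show ?thesis by simp
  qed

  \<comment> \<open>There are \<open>k * J\<close> unknown message entries and only
    \<open>(k - 1) * J\<close> equations, namely that the columns \<open>1\<close> to
    \<open>k - 1\<close> vanish. For \<open>k = 1\<close> there are no equations.\<close>
  obtain m where m: "\<And>s. m s \<in> carrier_mat 1 J" and m_zero: "\<And>i. 1 \<le> i \<Longrightarrow> i < k \<Longrightarrow> w m i = 0"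
    and m_nz: "\<exists>s<k. \<exists>r<J. m s $$ (0, r) \<noteq> 0"
  proof -
    let ?S = "{..<k} \<times> {..<J}" and ?T = "{1..<k} \<times> {..<J}"
    let ?X = "\<lambda>s i. G * cyclic_mat L ^\<^sub>m (q ^ s * l i) * Q"
    have "card ?T < card ?S" using k J by simp
    then obtain x where x: "\<exists>p\<in>?S. x p \<noteq> 0"
      and x0: "\<And>i t. 1 \<le> i \<Longrightarrow> i < k \<Longrightarrow> t < J \<Longrightarrow> (\<Sum>(s, r)\<in>?S. ?X s i $$ (r, t) * x (s, r)) = 0"
      using nontrivial_solution_of_linear_system[of ?S ?T "\<lambda>(i, t) (s, r). ?X s i $$ (r, t)"]
      by (force simp: case_prod_unfold)
    define m where "m s = mat 1 J (\<lambda>(_, r). x (s, r))" for s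
    have m: "m s \<in> carrier_mat 1 J" for s by (simp add: m_def)
    have "M m $$ (t, i) = 0" if i: "1 \<le> i" "i < k" and t: "t < J" for i t
    proof -
      have "M m $$ (t, i) = (\<Sum>s<k. \<Sum>r<J. ?X s i $$ (r, t) * x (s, r))"
        using i t k by (simp add: M_def row_mult_sandwich_index[OF L G(1) Q(1) m])
          (simp add: m_def mult.commute)
      then show ?thesis using x0[OF i t] by (simp add: sum.cartesian_product)
    qed
    then have "w m i = 0" if "1 \<le> i" "i < k" for i
      using that by (simp add: w_def)
    moreover have "\<exists>s<k. \<exists>r<J. m s $$ (0, r) \<noteq> 0"
      using x by (force simp: m_def)
    ultimately show thesis using that m by blast
  qed
  \<comment> \<open>Otherwise the first \<open>k\<close> columns all vanish, and so does the
    message.\<close>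
  have w0: "w m 0 \<noteq> 0"
  proof
    assume "w m 0 = 0"
    then have "w m i = 0" if "i < k" for i
      using m_zero that by (cases "i = 0") auto
    then have "m s $$ (0, r) = 0" if "s < k" "r < J" for s r
      using message_0[of m] m that by (auto simp: message_def)
    then show False using m_nz by blast
  qed
  have wS: "row_mat n (w m) \<in> S"
    using code[of m] m eq w_row[of m] by (simp add: matrix_code_def message_def)
  define \<delta> where "\<delta> = w m k / w m 0"
  have eig: "\<chi> j (x * \<delta>) = \<zeta> j * \<chi> j x" if j: "j \<in> I" for j x
  proof -
    \<comment> \<open>The scalar that turns column \<open>0\<close> into \<open>x\<close> and column
      \<open>k\<close> into \<open>x * \<delta>\<close>. The scaled word is again a codeword, with
      some message \<open>m'\<close>, and its columns \<open>1\<close> to \<open>k - 1\<close> still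
      vanish, so \<open>last\<close> applies to it.\<close>
    define a where "a = x / w m 0"
    define N where "N = mat J n (\<lambda>(t, i). \<kappa> (a * w m i) t)"
    have "row_mat J B * map_mat \<psi> N = a \<cdot>\<^sub>m row_mat n (w m)"
      by (rule eq_matI) (simp_all add: row_mat_def N_def scalar_prod_def atLeast0LessThan \<kappa>)
    then have "N \<in> matrix_code \<psi> J n B S"
      using S[OF wS, of a] by (simp add: matrix_code_def N_def)
    then obtain m' where m': "message m'" and N: "N = M m'"
      unfolding eq[symmetric] cs_code_def M_def message_def by blast
    have w': "w m' i = a * w m i" if "i < n" for i
      unfolding w_def[of m'] N[symmetric] using that by (simp add: N_def \<kappa>)
    have "\<chi> j (w m' k) = \<zeta> j * \<chi> j (w m' 0)"
      using k m_zero by (intro last[OF m' j]) (auto simp: w')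
    then show ?thesis
      using k w0 by (simp add: w' a_def \<delta>_def)
  qed
  \<comment> \<open>The sign does not depend on \<open>j\<close>, so \<open>inj_j\<close> carries
    over to \<open>\<zeta>\<close>.\<close>
  have "\<zeta> j = - ((- 1) ^ k) * \<beta> ^ (j * (\<Sum>s<k. c' * q ^ s))" for j
  proof -
    have "(\<Prod>s<k. - g j s) = (\<Prod>s<k. (- 1) * g j s)" by simp
    also have "\<dots> = (- 1) ^ k * (\<Prod>s<k. g j s)"
      by (simp only: prod.distrib) simp
    also have "(\<Prod>s<k. g j s) = \<beta> ^ (j * (\<Sum>s<k. c' * q ^ s))"
      by (simp add: g_def power_sum sum_distrib_left mult.assoc)
    finally show ?thesis by (simp add: \<zeta>_def)
  qed
  then have "inj_on \<zeta> I"
    using inj_j by (auto simp: inj_on_def)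
  then have "CARD('a) ^ card I \<le> CARD('b)"
    using card_power_le_of_eigenfunctionals[OF hom finite_subset[OF I(1)], of \<chi> \<zeta> \<delta>]
      \<chi>_add \<chi>_scale \<chi>_nz eig by blast
  then show False using card I(2) by simp
qed

subsection \<open>The polynomial of the non-primitive roots\<close>

lemma CHAR_eq_of_card_power:
  assumes "prime q" and "CARD('b::{field,finite}) = q ^ m"
  shows "CHAR('b) = q"
proof -
  have "CHAR('b) > 0" by (rule finite_imp_CHAR_pos) simp
  then have prime: "prime CHAR('b)" by (rule prime_CHAR_semidom)
  have "CHAR('b) dvd q ^ m"
    using CHAR_dvd_CARD[where 'a = 'b] assms(2) by simp
  with prime have "CHAR('b) dvd q"
    by (rule prime_dvd_power)
  then show ?thesis
    using prime assms(1) by (simp add: primes_dvd_imp_eq)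
qed

lemma frobenius_hom:
  assumes "prime CHAR('b::field)"
  shows "comm_ring_hom (\<lambda>x :: 'b. x ^ CHAR('b))"
proof
  show "(x + y) ^ CHAR('b) = x ^ CHAR('b) + y ^ CHAR('b)" for x y :: 'b
    using assms by (rule freshmans_dream) simp
qed (use assms in \<open>auto simp: power_mult_distrib power_0_left dest: prime_gt_0_nat\<close>)

text \<open>With \<open>q\<close> the characteristic, the polynomial \<open>x^q - x\<close> has at
  most \<open>q\<close> roots, and the \<open>q\<close> distinct multiples of 1 already are that
  many.\<close>

lemma frobenius_fixed_in_prime_field:
  fixes x :: "'b::field"
  assumes prime: "prime CHAR('b)" and x: "x ^ CHAR('b) = x"
  shows "\<exists>i. x = of_nat i"
proof -
  let ?q = "CHAR('b)"
  interpret F: comm_ring_hom "\<lambda>x :: 'b. x ^ ?q"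
    using prime by (rule frobenius_hom)
  define P :: "'b poly" where "P = monom 1 ?q - monom 1 1"
  define R where "R = {y. poly P y = 0}"
  have R: "y \<in> R \<longleftrightarrow> y ^ ?q = y" for y
    by (simp add: R_def P_def poly_monom)
  have q: "?q > 1" using prime by (rule prime_gt_1_nat)
  have "coeff P ?q = 1" using q by (simp add: P_def)
  then have nz: "P \<noteq> 0" by auto
  have "degree P \<le> ?q"
    using q by (intro degree_le) (simp add: P_def)
  then have "card R \<le> ?q"
    using card_poly_roots_bound[OF nz] by (simp add: R_def)
  have fin: "finite R"
    using nz poly_roots_finite by (simp add: R_def)
  have "inj_on (of_nat :: nat \<Rightarrow> 'b) {..<?q}"
    by (auto simp: inj_on_def of_nat_eq_iff_cong_CHAR cong_def)
  then have "card ((of_nat :: nat \<Rightarrow> 'b) ` {..<?q}) = ?q"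
    by (simp add: card_image)
  moreover have "(of_nat :: nat \<Rightarrow> 'b) ` {..<?q} \<subseteq> R"
    using F.hom_of_nat by (auto simp: R)
  ultimately have "of_nat ` {..<?q} = R"
    using \<open>card R \<le> ?q\<close> fin by (intro card_seteq) auto
  then show ?thesis
    using x by (auto simp flip: R)
qed

text \<open>This is the action of Frobenius on the exponents of \<open>\<beta>\<close>.
  Multiplication by a unit modulo \<open>L\<close> is injective and does not change coprimality to
  \<open>L\<close>.\<close>

lemma bij_betw_mult_mod_non_coprime:
  assumes L: "L > 0" and q: "coprime q L"
  shows "bij_betw (\<lambda>j. j * q mod L) ({0..<L} - coprime_idx L) ({0..<L} - coprime_idx L)"
proof -
  let ?K = "{0..<L} - coprime_idx L" and ?f = "\<lambda>j. j * q mod L"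
  have inj: "inj_on ?f ?K"
  proof (rule inj_onI)
    fix i j assume ij: "i \<in> ?K" "j \<in> ?K" "i * q mod L = j * q mod L"
    then have "[i = j] (mod L)"
      using q by (simp add: cong_mult_rcancel_nat flip: cong_def)
    then show "i = j" using ij by (simp add: cong_def)
  qed
  have "?f j \<in> ?K" if j: "j \<in> ?K" for j
  proof -
    have False if *: "?f j \<in> coprime_idx L"
    proof -
      have "coprime j L"
        using * by (auto simp: coprime_idx_def coprime_mod_left_iff)
      \<comment> \<open>For \<open>L = 1\<close> the index \<open>0\<close> is coprime to
        \<open>L\<close> but lies outside \<open>coprime_idx L\<close>, so positivity is checked
        separately.\<close>
      moreover have "j \<noteq> 0" using * by (intro notI) (simp add: coprime_idx_def)
      ultimately show False using j by (auto simp: coprime_idx_def)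
    qed
    then show ?thesis using L by auto
  qed
  then have "?f ` ?K = ?K"
    using inj by (intro endo_inj_surj) auto
  with inj show ?thesis by (simp add: bij_betw_def)
qed

text \<open>The description in \<open>tau_poly\<close> denotes: Frobenius permutes the linear
  factors, hence fixes every coefficient, and the coefficients are therefore multiples of 1.\<close>

lemma map_poly_tau_poly:
  fixes \<phi> :: "'a::field \<Rightarrow> 'b::{field,finite}"
  assumes L: "L > 0" and q: "prime q" "coprime q L" and card: "CARD('b) = q ^ m"
    and hom: "field_hom \<phi>" and prim: "primitive_root_of_unity L \<beta>"
  shows "map_poly \<phi> (tau_poly \<phi> L \<beta>) = (\<Prod>j\<in>{0..<L} - coprime_idx L. [:- (\<beta> ^ j), 1:])"
    (is "_ = ?T")
proof -
  interpret \<phi>: field_hom \<phi> by fact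
  let ?K = "{0..<L} - coprime_idx L"
  have char: "CHAR('b) = q" using q(1) card by (rule CHAR_eq_of_card_power)
  interpret F: comm_ring_hom "\<lambda>x :: 'b. x ^ q"
    using frobenius_hom[where 'b = 'b] q by (simp add: char)
  interpret FP: map_poly_comm_ring_hom "\<lambda>x :: 'b. x ^ q" ..
  have "map_poly (\<lambda>x. x ^ q) ?T = (\<Prod>j\<in>?K. [:- (\<beta> ^ (j * q mod L)), 1:])"
    by (simp add: FP.hom_prod map_poly_pCons F.hom_uminus primitive_root_power_mod[OF prim]
        flip: power_mult)
  also have "\<dots> = ?T"
    by (rule prod.reindex_bij_betw[OF bij_betw_mult_mod_non_coprime[OF L q(2)]])
  finally have "coeff ?T i ^ q = coeff ?T i" for i
    by (metis F.coeff_map_poly_hom)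
  then have "\<exists>n. coeff ?T i = of_nat n" for i
    using frobenius_fixed_in_prime_field[of "coeff ?T i"] q by (simp add: char)
  then obtain f where f: "\<And>i. coeff ?T i = of_nat (f i)" by metis
  \<comment> \<open>Ring homomorphisms preserve \<open>of_nat\<close>, so a natural number naming a
    coefficient also names its preimage under \<open>\<phi>\<close>.\<close>
  define p :: "'a poly" where "p = (\<Sum>i\<le>degree ?T. monom (of_nat (f i)) i)"
  have p: "map_poly \<phi> p = ?T"
  proof (rule poly_eqI)
    fix i
    have "coeff (map_poly \<phi> p) i = (if i \<le> degree ?T then of_nat (f i) else 0)"
      by (simp add: coeff_map_poly p_def coeff_sum \<phi>.hom_of_nat)
    then show "coeff (map_poly \<phi> p) i = coeff ?T i"
      using f[of i] by (auto simp: coeff_eq_0)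
  qed
  have unique: "r = p" if "map_poly \<phi> r = ?T" for r
  proof (rule poly_eqI)
    fix i
    have "\<phi> (coeff r i) = \<phi> (coeff p i)"
      using that p by (metis \<phi>.coeff_map_poly_hom)
    then show "coeff r i = coeff p i" by simp
  qed
  have "tau_poly \<phi> L \<beta> = p"
    unfolding tau_poly_def using p unique by (rule the_equality)
  with p show ?thesis by simp
qed

text \<open>The index \<open>(L - j) mod L\<close> stands for the negative of \<open>j\<close>; the
  reduction matters at \<open>j = 0\<close>.\<close>

lemma primitive_root_power_neg_index:
  assumes L: "L > 0" and prim: "primitive_root_of_unity L \<beta>" and j: "j < L"
  shows "inverse (\<beta> ^ (a mod L * ((L - j) mod L))) = \<beta> ^ (a * j)"
proof -
  have "\<beta> ^ (a mod L * ((L - j) mod L)) = \<beta> ^ (a * (L - j))"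
    by (simp add: primitive_root_power_eq_iff[OF L prim] cong_def mod_mult_eq)
  moreover have "\<beta> ^ (a * (L - j)) * \<beta> ^ (a * j) = \<beta> ^ (a * L)"
    using j by (simp add: algebra_simps flip: power_add distrib_left)
  moreover have "\<beta> ^ (a * L) = 1"
    using primitive_root_power_eq_iff[OF L prim, of "a * L" 0] by (simp add: cong_def)
  ultimately show ?thesis
    by (metis inverse_unique)
qed

text \<open>Column \<open>j\<close> of \<open>vandermonde_mat\<close> is an eigenvector of the
  cyclic shift with eigenvalue \<open>\<beta> ^ j\<close>, so \<open>p\<close> of the shift scales
  it by the value of \<open>p\<close> there. The inverse powers in \<open>transpose_mat G\<close>
  become positive after negating the index, which reverses the columns of \<open>U\<close>.\<close>

lemma poly_at_cyclic_mat_mult_transpose: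
  fixes G :: "'a::field mat" and U :: "'b::field mat"
  assumes L: "L > 0" and hom: "field_hom \<phi>" and prim: "primitive_root_of_unity L \<beta>"
    and U: "U \<in> carrier_mat J L"
    and G: "G \<in> carrier_mat J L" "map_mat \<phi> G = U * vandermonde_inv_mat L \<beta>"
  shows "map_mat \<phi> (poly_at_mat p (cyclic_mat L) * transpose_mat G) = vandermonde_mat L \<beta> *
    transpose_mat (mat J L (\<lambda>(t, j). poly (map_poly \<phi> p) (\<beta> ^ j) * U $$ (t, (L - j) mod L)))"
    (is "map_mat \<phi> (?P * _) = _ * transpose_mat ?V")
proof (rule eq_matI)
  interpret \<phi>: field_hom \<phi> by fact
  have C: "(cyclic_mat L :: 'a mat) \<in> carrier_mat L L" using L by (rule cyclic_mat_carrier)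
  then have P: "?P \<in> carrier_mat L L" by (simp add: poly_at_mat_def)
  have V: "?V \<in> carrier_mat J L" by simp
  fix i t assume "i < dim_row (vandermonde_mat L \<beta> * transpose_mat ?V)"
    and "t < dim_col (vandermonde_mat L \<beta> * transpose_mat ?V)"
  then have i: "i < L" and t: "t < J" by (simp_all add: vandermonde_mat_def)
  have Gi: "\<phi> (G $$ (t, i)) = (\<Sum>j<L. U $$ (t, j) * inverse (\<beta> ^ (i * j)))" if "i < L" for i
    using mult_vandermonde_inv_index[OF U t that, of \<beta>] G t that
    by (metis carrier_matD index_map_mat(1))
  have bij: "bij_betw (\<lambda>j. (L - j) mod L) {..<L} {..<L}"
    by (rule bij_betw_byWitness[where f' = "\<lambda>j. (L - j) mod L"])
      (use L in \<open>auto simp: mod_if\<close>)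
  have Gs: "\<phi> (G $$ (t, (i + s) mod L)) = (\<Sum>j<L. U $$ (t, (L - j) mod L) * \<beta> ^ ((i + s) * j))" for s
  proof -
    have "\<phi> (G $$ (t, (i + s) mod L)) = (\<Sum>j<L. U $$ (t, j) * inverse (\<beta> ^ ((i + s) mod L * j)))"
      using L by (intro Gi) simp
    also have "\<dots> = (\<Sum>j<L. U $$ (t, (L - j) mod L) * inverse (\<beta> ^ ((i + s) mod L * ((L - j) mod L))))"
      by (rule sum.reindex_bij_betw[OF bij, symmetric])
    also have "\<dots> = (\<Sum>j<L. U $$ (t, (L - j) mod L) * \<beta> ^ ((i + s) * j))"
      by (intro sum.cong) (auto simp: primitive_root_power_neg_index[OF L prim])
    finally show ?thesis .
  qed
  have "(?P * transpose_mat G) $$ (i, t) = (\<Sum>j<L. ?P $$ (i, j) * G $$ (t, j))"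
    using mult_mat_index[OF P transpose_carrier_mat[THEN iffD2, OF G(1)] i t] G t by simp
  also have "\<dots> = (\<Sum>j<L. \<Sum>s\<le>degree p. if j = (i + s) mod L then coeff p s * G $$ (t, j) else 0)"
  proof (rule sum.cong[OF refl])
    fix j assume "j \<in> {..<L}"
    then have "?P $$ (i, j) = (\<Sum>s\<le>degree p. if j = (i + s) mod L then coeff p s else 0)"
      using i C by (auto simp: poly_at_mat_def cyclic_mat_pow_index intro!: sum.cong)
    then show "?P $$ (i, j) * G $$ (t, j)
        = (\<Sum>s\<le>degree p. if j = (i + s) mod L then coeff p s * G $$ (t, j) else 0)"
      by (auto simp: sum_distrib_right intro!: sum.cong)
  qed
  also have "\<dots> = (\<Sum>s\<le>degree p. coeff p s * G $$ (t, (i + s) mod L))"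
    using L by (subst sum.swap) simp
  finally have "\<phi> ((?P * transpose_mat G) $$ (i, t))
      = (\<Sum>s\<le>degree p. \<Sum>j<L. \<phi> (coeff p s) * (U $$ (t, (L - j) mod L) * \<beta> ^ ((i + s) * j)))"
    by (simp add: \<phi>.hom_sum \<phi>.hom_mult Gs sum_distrib_left)
  also have "\<dots> = (\<Sum>j<L. \<Sum>s\<le>degree p. \<phi> (coeff p s) * (U $$ (t, (L - j) mod L) * \<beta> ^ ((i + s) * j)))"
    by (rule sum.swap)
  also have "\<dots> = (\<Sum>j<L. \<beta> ^ (i * j) * ?V $$ (t, j))"
  proof (rule sum.cong[OF refl])
    fix j assume "j \<in> {..<L}"
    moreover have pow: "\<beta> ^ ((i + s) * j) = \<beta> ^ (i * j) * \<beta> ^ (s * j)" for s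
      by (simp add: distrib_right power_add)
    moreover have "poly (map_poly \<phi> p) (\<beta> ^ j) = (\<Sum>s\<le>degree p. \<phi> (coeff p s) * \<beta> ^ (s * j))"
      by (simp add: poly_altdef mult.commute[of _ j] power_mult)
    ultimately show "(\<Sum>s\<le>degree p. \<phi> (coeff p s) * (U $$ (t, (L - j) mod L) * \<beta> ^ ((i + s) * j)))
        = \<beta> ^ (i * j) * ?V $$ (t, j)"
      using t by (simp add: sum_distrib_left sum_distrib_right pow mult.assoc)
        (simp add: mult_ac)
  qed
  also have "\<dots> = (vandermonde_mat L \<beta> * transpose_mat ?V) $$ (i, t)"
    by (rule vandermonde_mult_transpose_index[OF V t i, symmetric])
  finally show "map_mat \<phi> (?P * transpose_mat G) $$ (i, t) = (vandermonde_mat L \<beta> * transpose_mat ?V) $$ (i, t)"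
    using i t G P by simp
qed (use G L in \<open>simp_all add: vandermonde_mat_def poly_at_mat_def carrier_matD[OF cyclic_mat_carrier]\<close>)

text \<open>The selected columns of \<open>U'\<close>, transposed, are \<open>a\<close> times the
  inverse of those of \<open>U\<close>. Multiplying by this inverse on the left gives the first
  relation, on the right the second.\<close>

lemma select_cols_inverse:
  fixes U U' :: "'b::field mat"
  assumes U: "U \<in> carrier_mat J L" and U': "U' \<in> carrier_mat J L"
    and I: "I \<subseteq> {..<L}" "card I = J"
    and rank: "vec_space.rank J (select_cols U I) = J"
    and inv: "transpose_mat (select_cols U' I) = a \<cdot>\<^sub>m the (mat_inverse (select_cols U I))"
  shows "\<And>i j. i \<in> I \<Longrightarrow> j \<in> I \<Longrightarrow> (\<Sum>t<J. U' $$ (t, i) * U $$ (t, j)) = (if i = j then a else 0)"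
    and "\<And>r t. r < J \<Longrightarrow> t < J \<Longrightarrow> (\<Sum>j\<in>I. U $$ (r, j) * U' $$ (t, j)) = (if r = t then a else 0)"
proof -
  \<comment> \<open>The position of column \<open>j\<close> after the selection.\<close>
  define p where "p j = card {a \<in> I. a < j}" for j
  have fin: "finite I" using I(1) finite_subset by blast
  have p_inj: "inj_on p I"
    by (rule inj_on_inverseI[of _ "pick I"]) (simp add: p_def pick_card_in_set)
  have p_less: "p j < J" if "j \<in> I" for j
    unfolding p_def I(2)[symmetric] using that fin by (intro psubset_card_mono) auto
  then have "p ` I \<subseteq> {..<J}" by auto
  then have "p ` I = {..<J}"
    using p_inj I(2) by (intro card_subset_eq) (simp_all add: card_image)
  with p_inj have p_bij: "bij_betw p I {..<J}" by (simp add: bij_betw_def)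
  have dims: "{i. i < L \<and> i \<in> I} = I" "{i. i < J \<and> i \<in> (UNIV :: nat set)} = {..<J}"
    using I by auto
  have carrier: "select_cols A I \<in> carrier_mat J J" if "A \<in> carrier_mat J L" for A :: "'b mat"
    using that I dims by (auto simp: select_cols_def dim_submatrix)
  have entry: "select_cols A I $$ (t, p j) = A $$ (t, j)"
    if "A \<in> carrier_mat J L" "t < J" "j \<in> I" for A :: "'b mat" and t j
  proof -
    have "card {a. a < t} = t" by (simp flip: lessThan_def)
    then show ?thesis
      using submatrix_index_card[of t A j UNIV I] that I(1)
      by (auto simp: select_cols_def p_def)
  qed
  let ?X = "select_cols U I"
  \<comment> \<open>Full rank ensures that \<open>mat_inverse\<close> returns \<open>Some\<close>,
    so that \<open>the\<close> in the hypothesis yields the actual inverse.\<close>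
  have "det ?X \<noteq> 0"
    using rank vec_space.det_rank_iff[OF carrier[OF U]] by blast
  then have "?X \<in> Units (ring_mat TYPE('b) J ())"
    by (rule det_non_zero_imp_unit[OF carrier[OF U]])
  then obtain Y where "mat_inverse ?X = Some Y"
    using mat_inverse(1)[OF carrier[OF U], where b = "()"] by (cases "mat_inverse ?X") auto
  with mat_inverse(2)[OF carrier[OF U]] inv
  have XY: "?X * Y = 1\<^sub>m J" and YX: "Y * ?X = 1\<^sub>m J" and Y: "Y \<in> carrier_mat J J"
    and U'Y: "transpose_mat (select_cols U' I) = a \<cdot>\<^sub>m Y"
    by auto
  have U'_entry: "U' $$ (t, j) = a * Y $$ (p j, t)" if "t < J" "j \<in> I" for t j
  proof -
    have "U' $$ (t, j) = transpose_mat (select_cols U' I) $$ (p j, t)"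
      using that entry[OF U' that] carrier[OF U'] p_less by simp
    then show ?thesis using that p_less Y by (simp add: U'Y)
  qed
  show "(\<Sum>t<J. U' $$ (t, i) * U $$ (t, j)) = (if i = j then a else 0)" if ij: "i \<in> I" "j \<in> I" for i j
  proof -
    have "(\<Sum>t<J. U' $$ (t, i) * U $$ (t, j)) = a * (\<Sum>t<J. Y $$ (p i, t) * ?X $$ (t, p j))"
      using ij by (simp add: U'_entry entry[OF U] sum_distrib_left mult.assoc)
    also have "\<dots> = a * (1\<^sub>m J) $$ (p i, p j)"
      using mult_mat_index[OF Y carrier[OF U], of "p i" "p j"] ij p_less by (simp add: YX)
    finally show ?thesis
      using ij p_less p_inj by (auto simp: inj_on_def)
  qed
  show "(\<Sum>j\<in>I. U $$ (r, j) * U' $$ (t, j)) = (if r = t then a else 0)" if rt: "r < J" "t < J" for r t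
  proof -
    have "(\<Sum>j\<in>I. U $$ (r, j) * U' $$ (t, j)) = (\<Sum>j\<in>I. a * (?X $$ (r, p j) * Y $$ (p j, t)))"
      using rt by (simp add: U'_entry entry[OF U] mult_ac)
    also have "\<dots> = (\<Sum>j<J. a * (?X $$ (r, j) * Y $$ (j, t)))"
      by (rule sum.reindex_bij_betw[OF p_bij])
    also have "\<dots> = a * (1\<^sub>m J) $$ (r, t)"
      using mult_mat_index[OF carrier[OF U] Y rt] by (simp add: XY sum_distrib_left)
    finally show ?thesis using rt by simp
  qed
qed

section \<open>Both codes as instances of the comparison\<close>

theorem proposition13:
  fixes q L m J k n c c' :: nat
    and l :: "nat \<Rightarrow> nat"
    and \<phi> :: "'a::{field,finite} \<Rightarrow> 'b::{field,finite}"
    and \<psi> :: "'a \<Rightarrow> 'c::{field,finite}"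
    and \<beta> :: 'b
    and U U' :: "'b mat"
    and G H :: "'a mat"
    and B b :: "nat \<Rightarrow> 'c"
    and \<eta> :: 'c
  assumes "m = ord L q" and "J = card (coprime_idx L)"
    and "prime q" and "L > 0" and "coprime q L"
    and "CARD('a) = q" and "CARD('b) = q ^ m" and "CARD('c) = q ^ J"
    and "field_hom \<phi>" and "field_hom \<psi>"
    and "primitive_root_of_unity L \<beta>"
    and "U \<in> carrier_mat J L" and "U' \<in> carrier_mat J L"
    and "vec_space.rank J (select_cols U (coprime_idx L)) = J"
    and "transpose_mat (select_cols U' (coprime_idx L)) =
           inverse (of_nat L) \<cdot>\<^sub>m the (mat_inverse (select_cols U (coprime_idx L)))"
    and "(\<forall>j\<in>{0..<L} - coprime_idx L. col U j = 0\<^sub>v J) \<or>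
         (\<forall>j\<in>{0..<L} - coprime_idx L. col U' j = 0\<^sub>v J)"
    and "G \<in> carrier_mat J L" and "map_mat \<phi> G = U * vandermonde_inv_mat L \<beta>"
    and "H \<in> carrier_mat L J" and "map_mat \<phi> H = vandermonde_mat L \<beta> * transpose_mat U'"
    and "1 \<le> k" and "k < n" and "n \<le> m" and "m \<le> J" and "J \<noteq> m"
    and "c \<le> L - 1" and "1 \<le> c'" and "c' \<le> L - 1"
    and "coprime (\<Sum>j<k. c' * q ^ j) L"
    and "\<forall>j<n. l j = (c' * j + c) mod L"
    and "cs_mrd_exponents L J n l G H"
    and "cs_mrd_exponents L J n l G
           (poly_at_mat (tau_poly \<phi> L \<beta>) (cyclic_mat L) * transpose_mat G)"
    and "basis_family \<psi> J B"
    and "twisted_gabidulin_params \<psi> q J n k \<eta> b"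
  shows "cs_code q L J k n l G H \<noteq>
           matrix_code \<psi> J n B (twisted_gabidulin q n k 0 \<eta> b) \<and>
         cs_code q L J k n l G
             (poly_at_mat (tau_poly \<phi> L \<beta>) (cyclic_mat L) * transpose_mat G) \<noteq>
           matrix_code \<psi> J n B (twisted_gabidulin q n k 0 \<eta> b)"
proof -
  note q = \<open>prime q\<close> and L = \<open>L > 0\<close> and prim = \<open>primitive_root_of_unity L \<beta>\<close>
    and hom = \<open>field_hom \<phi>\<close> \<open>field_hom \<psi>\<close>
    and U = \<open>U \<in> carrier_mat J L\<close> and U' = \<open>U' \<in> carrier_mat J L\<close>
    and G = \<open>G \<in> carrier_mat J L\<close> \<open>map_mat \<phi> G = U * vandermonde_inv_mat L \<beta>\<close>
    and H = \<open>H \<in> carrier_mat L J\<close> \<open>map_mat \<phi> H = vandermonde_mat L \<beta> * transpose_mat U'\<close>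
    and B = \<open>basis_family \<psi> J B\<close> and k = \<open>1 \<le> k\<close> \<open>k < n\<close>
  define I where "I = coprime_idx L"
  define S where "S = twisted_gabidulin q n k 0 \<eta> b"
  have I_iff: "j \<in> I \<longleftrightarrow> 1 \<le> j \<and> j < L \<and> coprime j L" for j
    using L by (auto simp: I_def coprime_idx_def)
  have I: "I \<subseteq> {..<L}" "card I = J"
    using \<open>J = card (coprime_idx L)\<close> by (auto simp: I_iff, simp add: I_def)
  have J: "J > 0" using \<open>1 \<le> k\<close> \<open>k < n\<close> \<open>n \<le> m\<close> \<open>m \<le> J\<close> by simp
  have char: "CHAR('b) = q"
    using q \<open>CARD('b) = q ^ m\<close> by (rule CHAR_eq_of_card_power)
  have "\<not> q dvd L"
    using q \<open>coprime q L\<close> by (metis coprime_absorb_left not_prime_unit)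
  then have L_nz: "(of_nat L :: 'b) \<noteq> 0"
    by (simp add: of_nat_eq_0_iff_char_dvd char)
  have orth: "(\<Sum>t<J. U' $$ (t, i) * U $$ (t, j)) = (if i = j then inverse (of_nat L) else 0)"
    if "i \<in> I" "j \<in> I" for i j
    using select_cols_inverse(1)[OF U U' I] assms(14,15) that unfolding I_def by blast
  have orth': "(\<Sum>j\<in>I. U $$ (r, j) * U' $$ (t, j)) = (if r = t then inverse (of_nat L) else 0)"
    if "r < J" "t < J" for r t
    using select_cols_inverse(2)[OF U U' I] assms(14,15) that unfolding I_def by blast
  have W: "(\<Sum>j\<in>I. U $$ (r, j) * (of_nat L * U' $$ (t, j))) = (if r = t then 1 else 0)"
    if "r < J" "t < J" for r t
    using orth'[OF that] L_nz by (simp add: mult.left_commute[of _ "of_nat L"] flip: sum_distrib_left)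
  have cop: "coprime j L" if "j \<in> I" for j
    using that by (simp add: I_iff)
  have inj_j: "inj_on (\<lambda>j. \<beta> ^ (j * (\<Sum>s<k. c' * q ^ s))) I"
  proof (rule inj_onI)
    fix i j assume ij: "i \<in> I" "j \<in> I" "\<beta> ^ (i * (\<Sum>s<k. c' * q ^ s)) = \<beta> ^ (j * (\<Sum>s<k. c' * q ^ s))"
    then have "[i = j] (mod L)"
      using \<open>coprime (\<Sum>j<k. c' * q ^ j) L\<close>
      by (simp only: primitive_root_power_eq_iff[OF L prim] cong_mult_rcancel_nat)
    then show "i = j" using ij by (simp add: cong_def I_iff)
  qed
  \<comment> \<open>A common factor of \<open>c'\<close> and \<open>L\<close> would divide the whole
    sum.\<close>
  have "coprime c' L"
    using \<open>coprime (\<Sum>j<k. c' * q ^ j) L\<close> by (simp flip: sum_distrib_left)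
  have inj_s: "inj_on (\<lambda>s. \<beta> ^ (j * c' * q ^ s)) {..<k}" if j: "j \<in> I" for j
  proof (rule inj_onI)
    fix s t assume st: "s \<in> {..<k}" "t \<in> {..<k}" "\<beta> ^ (j * c' * q ^ s) = \<beta> ^ (j * c' * q ^ t)"
    have "coprime (j * c') L"
      using cop[OF j] \<open>coprime c' L\<close> by simp
    with st have "[q ^ s = q ^ t] (mod L)"
      by (simp only: primitive_root_power_eq_iff[OF L prim] cong_mult_lcancel_nat)
    \<comment> \<open>Since \<open>m\<close> is the order of \<open>q\<close>, equal powers have
      congruent exponents; both lie below \<open>k\<close>, hence below \<open>m\<close>.\<close>
    then have "[s = t] (mod m)"
      using \<open>coprime q L\<close> \<open>m = ord L q\<close> by (simp add: order_divides_expdiff coprime_commute)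
    then show "s = t"
      using st \<open>k < n\<close> \<open>n \<le> m\<close> by (simp add: cong_def)
  qed
  \<comment> \<open>Here \<open>J \<noteq> m\<close> makes the field of the roots of unity strictly
    too small.\<close>
  have card: "CARD('b) < CARD('a) ^ J"
    using \<open>CARD('a) = q\<close> \<open>CARD('b) = q ^ m\<close> \<open>m \<le> J\<close> \<open>J \<noteq> m\<close> prime_gt_1_nat[OF q] by simp
  have S: "a \<cdot>\<^sub>m w \<in> S" if "w \<in> S" for a w
    using that unfolding S_def by (rule twisted_gabidulin_smult_closed)
  have l: "\<And>i. i < n \<Longrightarrow> l i = (c' * i + c) mod L"
    using \<open>\<forall>j<n. l j = (c' * j + c) mod L\<close> by blast

  have "cs_code q L J k n l G H \<noteq> matrix_code \<psi> J n B S"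
  \<comment> \<open>For the first code \<open>V\<close> is \<open>U'\<close>, the dual family
    \<open>Z\<close> is \<open>U\<close> itself, and \<open>W\<close> is \<open>of_nat L\<close>
    times \<open>U'\<close>.\<close>
  proof (rule cs_code_neq_matrix_code[OF L hom prim U U' G H I J _ _ W k l inj_s inj_j card B S])
    fix j r t assume j: "j < L" "j \<notin> I" and rt: "r < J" "t < J"
    then have "col U j = 0\<^sub>v J \<or> col U' j = 0\<^sub>v J"
      using assms(16) by (auto simp: I_def)
    then have "U $$ (r, j) = 0 \<or> U' $$ (t, j) = 0"
      using j rt U U' by (metis carrier_matD index_col index_zero_vec(1))
    then show "U $$ (r, j) * U' $$ (t, j) = 0" by auto
  next
    fix i j assume "i \<in> I" "j \<in> I"
    then show "of_nat L * (\<Sum>t<J. U' $$ (t, i) * U $$ (t, j)) = (if i = j then 1 else 0)"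
      using orth L_nz by simp
  qed
  moreover have "cs_code q L J k n l G (poly_at_mat (tau_poly \<phi> L \<beta>) (cyclic_mat L) * transpose_mat G)
      \<noteq> matrix_code \<psi> J n B S"
  proof -
    let ?Q = "poly_at_mat (tau_poly \<phi> L \<beta>) (cyclic_mat L) * transpose_mat G"
    define T where "T = map_poly \<phi> (tau_poly \<phi> L \<beta>)"
    define V where "V = mat J L (\<lambda>(t, j). poly T (\<beta> ^ j) * U $$ (t, (L - j) mod L))"
    have V: "V \<in> carrier_mat J L" by (simp add: V_def)
    have Q: "?Q \<in> carrier_mat L J" "map_mat \<phi> ?Q = vandermonde_mat L \<beta> * transpose_mat V"
      using poly_at_cyclic_mat_mult_transpose[OF L hom(1) prim U G] G
      by (auto simp: V_def T_def poly_at_mat_def carrier_matD[OF cyclic_mat_carrier[OF L]])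
    have T: "poly T (\<beta> ^ i) = (\<Prod>j\<in>{0..<L} - I. \<beta> ^ i - \<beta> ^ j)" for i
      unfolding T_def map_poly_tau_poly[OF L q \<open>coprime q L\<close> \<open>CARD('b) = q ^ m\<close> hom(1) prim]
      by (simp add: I_def poly_prod)
    \<comment> \<open>Among the powers \<open>\<beta> ^ j\<close> with \<open>j < L\<close>, the
      roots of \<open>T\<close> are exactly those with \<open>j\<close> outside \<open>I\<close>. So
      \<open>V\<close> vanishes outside \<open>I\<close>, and on \<open>I\<close> division by the
      values of \<open>T\<close> is possible.\<close>
    have T_0: "poly T (\<beta> ^ j) = 0" if "j < L" "j \<notin> I" for j
      using that by (auto simp: T intro!: prod_zero)
    have T_nz: "poly T (\<beta> ^ i) \<noteq> 0" if "i \<in> I" for i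
      using that by (auto simp: T primitive_root_power_eq_iff[OF L prim] cong_def I_iff)
    \<comment> \<open>Negation modulo \<open>L\<close> preserves \<open>I\<close>; there is no
      wraparound since \<open>0\<close> is not in \<open>I\<close>.\<close>
    have neg: "L - j \<in> I" "(L - j) mod L = L - j" if j: "j \<in> I" for j
    proof -
      have "gcd (L - j) L = gcd j L"
        using j by (intro gcd_diff2_nat) (simp add: I_iff)
      then have "coprime (L - j) L"
        using cop[OF j] by (simp only: coprime_iff_gcd_eq_1)
      then show "L - j \<in> I" "(L - j) mod L = L - j"
        using j L by (auto simp: I_iff Suc_le_eq)
    qed
    show ?thesis
    proof (rule cs_code_neq_matrix_code[OF L hom prim U V G Q I J _ _ W k l inj_s inj_j card B S])
      fix j r t assume "j < L" "j \<notin> I" "r < J" "t < J"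
      then show "U $$ (r, j) * V $$ (t, j) = 0"
        using T_0 by (simp add: V_def)
    next
      fix i j assume ij: "i \<in> I" "j \<in> I"
      \<comment> \<open>Column \<open>i\<close> of \<open>V\<close> is column \<open>L - i\<close>
        of \<open>U\<close> scaled by \<open>poly T (\<beta> ^ i)\<close>, so the dual family takes
        column \<open>L - j\<close> of \<open>U'\<close> and divides by the matching value.\<close>
      let ?Z = "\<lambda>t j. U' $$ (t, L - j) / poly T (\<beta> ^ j)"
      have "(\<Sum>t<J. V $$ (t, i) * ?Z t j)
          = poly T (\<beta> ^ i) / poly T (\<beta> ^ j) * (\<Sum>t<J. U' $$ (t, L - j) * U $$ (t, L - i))"
        using ij I neg by (auto simp: V_def sum_distrib_left mult_ac intro!: sum.cong)
      also have "\<dots> = (if i = j then inverse (of_nat L) else 0)"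
        using ij orth[OF neg(1)[OF ij(2)] neg(1)[OF ij(1)]] T_nz by (auto simp: I_iff)
      finally show "of_nat L * (\<Sum>t<J. V $$ (t, i) * ?Z t j) = (if i = j then 1 else 0)"
        using L_nz by simp
    qed
  qed
  ultimately show ?thesis unfolding S_def by blast
qed

end
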